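(* Let $A$ be a finite-dimensional simple associative algebra over a field $F$ with $\mathrm{char}(F)\neq 2,3$. Then every local Jordan automorphism $T:A\to A$ is a Jordan automorphism.
   Context: A Jordan automorphism of $A$ is a bijective $F$-linear map $J:A\to A$ with $J(xy+yx)=J(x)J(y)+J(y)J(x)$ for all $x,y\in A$. A local Jordan automorphism is an $F$-linear map $T:A\to A$ such that for each $x\in A$ there exists a Jordan automorphism $T_x$ of $A$ with $T(x)=T_x(x)$. *)

theory Defs
  imports Complex_Main
begin

definition is_algebra :: "('f::field \<Rightarrow> 'a::ring \<Rightarrow> 'a) \<Rightarrow> bool" where
  "is_algebra scale \<longleftrightarrow> vector_space scale \<and>
     (\<forall>c x y. scale c (x * y) = scale c x * y \<and> scale c (x * y) = x * scale c y)"

definition fin_dim_algebra :: "('f::field \<Rightarrow> 'a::ring \<Rightarrow> 'a) \<Rightarrow> bool" where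
  "fin_dim_algebra scale \<longleftrightarrow> (\<exists>B. finite B \<and> module.span scale B = UNIV)"

definition alg_ideal :: "('f::field \<Rightarrow> 'a::ring \<Rightarrow> 'a) \<Rightarrow> 'a set \<Rightarrow> bool" where
  "alg_ideal scale I \<longleftrightarrow> module.subspace scale I \<and>
     (\<forall>a\<in>I. \<forall>x. x * a \<in> I \<and> a * x \<in> I)"

definition simple_algebra :: "('f::field \<Rightarrow> 'a::ring \<Rightarrow> 'a) \<Rightarrow> bool" where
  "simple_algebra scale \<longleftrightarrow> is_algebra scale \<and> (\<exists>x y::'a. x * y \<noteq> 0) \<and>
     (\<forall>I. alg_ideal scale I \<longrightarrow> I = {0} \<or> I = UNIV)"

definition jordan_automorphism :: "('f::field \<Rightarrow> 'a::ring \<Rightarrow> 'a) \<Rightarrow> ('a \<Rightarrow> 'a) \<Rightarrow> bool" where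
  "jordan_automorphism scale J \<longleftrightarrow> Vector_Spaces.linear scale scale J \<and> bij J \<and>
     (\<forall>x y. J (x * y + y * x) = J x * J y + J y * J x)"

definition local_jordan_automorphism :: "('f::field \<Rightarrow> 'a::ring \<Rightarrow> 'a) \<Rightarrow> ('a \<Rightarrow> 'a) \<Rightarrow> bool" where
  "local_jordan_automorphism scale T \<longleftrightarrow> Vector_Spaces.linear scale scale T \<and>
     (\<forall>x. \<exists>Tx. jordan_automorphism scale Tx \<and> T x = Tx x)"

end

theory Submission
  imports Defs
begin

text \<open>Let \<open>C\<close> be the space of sums of commutators. Suppose that a proper subspace \<open>N\<close> contains \<open>C\<close>
  and all \<open>J x - x\<close> with \<open>J\<close> a Jordan automorphism. Modulo \<open>N\<close>, a local Jordan automorphism \<open>T\<close>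
  satisfies \<open>T x \<equiv> x\<close>, \<open>(T x)\<^sup>2 \<equiv> x\<^sup>2\<close> and \<open>(T x)\<^sup>3 \<equiv> x\<^sup>3\<close>. Linearizing these congruences, which
  needs characteristic different from 2 and 3, shows that
  \<open>a = T (x * y + y * x) - (T x * T y + T y * T x)\<close> satisfies \<open>a * A \<subseteq> N\<close>; as \<open>N\<close> contains the
  commutators, the ideal generated by \<open>a\<close> lies in \<open>N\<close>, and \<open>a = 0\<close> by simplicity.

  The usual trace of left multiplications may vanish, so \<open>N\<close> is built without it. First,
  \<open>C \<noteq> A\<close>: the multiplication operators \<open>x \<mapsto> \<Sum>i. a i * x * b i\<close> form a tensor product
  over the center, and a central-valued one becomes, after swapping the tensor factors, a nonzero
  map that vanishes on commutators. A Jordan automorphism preserves \<open>C\<close> and the center, and if it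
  fixes the center pointwise then it acts trivially on \<open>A / C\<close>, by a Skolem-Noether argument in a
  division corner. Hence only the finitely many restrictions \<open>\<sigma>\<close> to the center matter; summing one
  representative \<open>J\<close> for each \<open>\<sigma>\<close> gives an invariant map on \<open>A / C\<close>, which is nonzero by
  Dedekind's independence of characters, and \<open>N\<close> is its kernel.\<close>

section \<open>Unit element and idempotents\<close>

locale fd_simple_algebra = finite_dimensional_vector_space scale Basis
  for scale :: "'f::field \<Rightarrow> 'a::ring \<Rightarrow> 'a" and Basis +
  assumes scale_mult_left: "scale c x * y = scale c (x * y)"
    and scale_mult_right: "x * scale c y = scale c (x * y)"
    and mult_nontrivial: "\<exists>x y::'a. x * y \<noteq> 0"
    and simple: "\<lbrakk>subspace I; \<And>a x. a \<in> I \<Longrightarrow> x * a \<in> I; \<And>a x. a \<in> I \<Longrightarrow> a * x \<in> I\<rbrakk>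
      \<Longrightarrow> I = {0} \<or> I = UNIV"
begin

text \<open>These elements form a two-sided ideal, which is proper because the multiplication is not
  identically zero.\<close>

lemma left_annihilator_trivial:
  fixes a :: 'a
  assumes "\<And>x. a * x = 0"
  shows "a = 0"
proof -
  let ?I = "{a::'a. \<forall>x. a * x = 0}"
  have "?I = {0} \<or> ?I = UNIV"
    by (rule simple) (auto simp: subspace_def scale_mult_left distrib_right mult.assoc)
  moreover have "?I \<noteq> UNIV"
    using mult_nontrivial by auto
  ultimately show ?thesis
    using assms by auto
qed

section \<open>Minimal right ideals and their idempotents\<close>

definition right_ideal :: "'a set \<Rightarrow> bool" where
  "right_ideal R \<longleftrightarrow> subspace R \<and> (\<forall>a\<in>R. \<forall>x. a * x \<in> R)"

definition minimal_right_ideal :: "'a set \<Rightarrow> bool" where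
  "minimal_right_ideal R \<longleftrightarrow> right_ideal R \<and> R \<noteq> {0} \<and>
     (\<forall>S. right_ideal S \<and> S \<subseteq> R \<longrightarrow> S = {0} \<or> S = R)"

lemma right_ideal_range: "right_ideal (range ((*) a))"
  unfolding right_ideal_def
proof (intro conjI ballI allI)
  show "subspace (range ((*) a))"
  proof (rule subspaceI)
    show "0 \<in> range ((*) a)" by (metis mult_zero_right rangeI)
    show "x + y \<in> range ((*) a)" if "x \<in> range ((*) a)" "y \<in> range ((*) a)" for x y
      using that by (auto simp flip: distrib_left)
    show "scale c x \<in> range ((*) a)" if "x \<in> range ((*) a)" for c x
      using that by (auto simp flip: scale_mult_right)
  qed
  show "x * y \<in> range ((*) a)" if "x \<in> range ((*) a)" for x y
    using that by (auto simp: mult.assoc)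
qed

lemma right_ideal_annihilator:
  assumes "right_ideal R"
  shows "right_ideal {s \<in> R. r * s = 0}"
  using assms
  by (auto simp: right_ideal_def subspace_def distrib_left scale_mult_right simp flip: mult.assoc)

lemma right_ideal_image:
  assumes "right_ideal R"
  shows "right_ideal ((*) r ` R)"
  unfolding right_ideal_def
proof (intro conjI ballI allI)
  note R = assms[unfolded right_ideal_def subspace_def]
  show "subspace ((*) r ` R)"
  proof (rule subspaceI)
    show "0 \<in> (*) r ` R" using R by (metis mult_zero_right imageI)
    show "x + y \<in> (*) r ` R" if "x \<in> (*) r ` R" "y \<in> (*) r ` R" for x y
      using that R by (auto simp flip: distrib_left)
    show "scale c x \<in> (*) r ` R" if "x \<in> (*) r ` R" for c x
      using that R by (auto simp flip: scale_mult_right)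
  qed
  show "x * y \<in> (*) r ` R" if "x \<in> (*) r ` R" for x y
    using that R by (auto simp: mult.assoc)
qed

lemma minimal_right_ideal_exists:
  assumes "right_ideal R" "R \<noteq> {0}"
  obtains M where "minimal_right_ideal M" "M \<subseteq> R"
proof -
  let ?P = "\<lambda>M. right_ideal M \<and> M \<noteq> {0} \<and> M \<subseteq> R"
  obtain M where M: "?P M" and min: "\<And>N. ?P N \<Longrightarrow> dim M \<le> dim N"
    using ex_has_least_nat[of ?P R dim] assms by auto
  have "minimal_right_ideal M"
    unfolding minimal_right_ideal_def
  proof (intro conjI allI impI)
    fix S assume S: "right_ideal S \<and> S \<subseteq> M"
    show "S = {0} \<or> S = M"
    proof (rule disjCI)
      assume "S \<noteq> M"
      then show "S = {0}"
        using S M min[of S] subspace_dim_equal[of S M]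
        unfolding right_ideal_def by blast
    qed
  qed (use M in auto)
  then show ?thesis using that M by blast
qed

text \<open>Brauer's argument: \<open>R * R\<close> is nonzero, so some \<open>r\<close> in
  \<open>R\<close> satisfies \<open>r * R = R\<close>, and minimality makes
  \<open>s \<mapsto> r * s\<close> injective on \<open>R\<close>. The solution \<open>e\<close> of
  \<open>r * e = r\<close> is then idempotent.\<close>

lemma minimal_right_ideal_idempotent:
  assumes "minimal_right_ideal R"
  obtains e where "e \<noteq> 0" "e * e = e" "e \<in> R" "R = range ((*) e)"
proof -
  have R: "right_ideal R" "R \<noteq> {0}"
    and min: "\<And>S. right_ideal S \<Longrightarrow> S \<subseteq> R \<Longrightarrow> S = {0} \<or> S = R"
    using assms by (auto simp: minimal_right_ideal_def)
  have sub: "subspace R" and closed: "\<And>a x. a \<in> R \<Longrightarrow> a * x \<in> R"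
    using R by (auto simp: right_ideal_def)
  have "\<exists>r\<in>R. \<exists>s\<in>R. r * s \<noteq> 0"
  proof (rule ccontr)
    assume neg: "\<not> ?thesis"
    \<comment> \<open>The right annihilator of \<open>R\<close> is a two-sided ideal. If it
      contained \<open>R\<close>, it would be everything, and \<open>R\<close> would vanish by
      \<open>left_annihilator_trivial\<close>.\<close>
    let ?I = "{a. \<forall>r\<in>R. r * a = 0}"
    have "?I = {0} \<or> ?I = UNIV"
      by (rule simple)
        (auto simp: subspace_def scale_mult_right distrib_left closed simp flip: mult.assoc)
    moreover have "R \<subseteq> ?I" using neg by auto
    ultimately have "?I = UNIV" using R subspace_0[OF sub] by auto
    then have "R \<subseteq> {0}" using left_annihilator_trivial by blast
    then show False using R subspace_0[OF sub] by auto
  qed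
  then obtain r s where rs: "r \<in> R" "s \<in> R" "r * s \<noteq> 0" by blast
  have "(*) r ` R = R"
    using min[OF right_ideal_image[OF R(1), of r]] closed rs by auto
  then obtain e where e: "e \<in> R" "r * e = r" using rs(1) by (metis imageE)
  have "{s \<in> R. r * s = 0} = {0}"
    using min[OF right_ideal_annihilator[OF R(1), of r]] rs by auto
  moreover have "e * e - e \<in> {s \<in> R. r * s = 0}"
    using e closed subspace_diff[OF sub] by (auto simp: right_diff_distrib simp flip: mult.assoc)
  ultimately have ee: "e * e = e" by auto
  have e0: "e \<noteq> 0" using e rs by auto
  have "e \<in> range ((*) e)" using ee by (metis rangeI)
  then have "range ((*) e) = R"
    using min[OF right_ideal_range[of e]] closed e e0 by auto
  then show ?thesis using that e0 ee e by metis
qed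

text \<open>An idempotent \<open>e\<close> with \<open>e * A\<close> of largest dimension has zero
  right annihilator, since an idempotent \<open>f\<close> in it would allow \<open>e * A\<close> to
  be enlarged. As \<open>e * x - x\<close> lies in this annihilator, \<open>e\<close> is a left
  unit.\<close>

lemma left_unit_exists: "\<exists>e. \<forall>x::'a. e * x = x"
proof -
  let ?P = "\<lambda>e::'a. e * e = e"
  have "\<exists>e. ?P e \<and> (\<forall>g. ?P g \<longrightarrow> dim (range ((*) g)) \<le> dim (range ((*) e)))"
    by (rule ex_has_greatest_nat[of ?P 0 _ "Suc dimension"])
       (auto simp: le_imp_less_Suc dim_subset_UNIV)
  then obtain e where e: "e * e = e"
    and max: "\<And>g. g * g = g \<Longrightarrow> dim (range ((*) g)) \<le> dim (range ((*) e))"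
    by blast
  let ?R = "{x. e * x = 0}"
  have "right_ideal UNIV" by (simp add: right_ideal_def)
  from right_ideal_annihilator[OF this, of e] have R: "right_ideal ?R" by simp
  have "?R = {0}"
  proof (rule ccontr)
    assume "?R \<noteq> {0}"
    then obtain M where "minimal_right_ideal M" "M \<subseteq> ?R"
      using minimal_right_ideal_exists[OF R] by blast
    then obtain f where f: "f \<noteq> 0" "f * f = f" "e * f = 0"
      using minimal_right_ideal_idempotent by (metis (mono_tags, lifting) mem_Collect_eq subsetD)
    \<comment> \<open>The correction \<open>f * e\<close> is chosen so that \<open>g\<close> fixes
      both \<open>e\<close> and \<open>f\<close> from the left, which also makes \<open>g\<close>
      idempotent.\<close>
    define g where "g = e + f - f * e"
    have ge: "g * e = e" by (simp add: g_def algebra_simps e)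
    have gf: "g * f = f" by (simp add: g_def algebra_simps f)
    have "g * g = g * e + g * f - g * f * e"
      by (simp add: g_def[of] algebra_simps)
    then have "g * g = g" by (simp add: ge gf) (simp add: g_def)
    then have "dim (range ((*) g)) \<le> dim (range ((*) e))" by (rule max)
    moreover have "range ((*) e) \<subseteq> range ((*) g)"
    proof
      fix z assume "z \<in> range ((*) e)"
      then obtain y where "z = e * y" by blast
      then have "z = g * (e * y)" by (simp add: ge flip: mult.assoc)
      then show "z \<in> range ((*) g)" by blast
    qed
    ultimately have "range ((*) e) = range ((*) g)"
      using subspace_dim_equal right_ideal_range right_ideal_def by metis
    moreover have "f \<in> range ((*) g)" using gf by (metis rangeI)
    ultimately obtain y where "f = e * y" by blast
    then have "e * f = f" by (simp add: e flip: mult.assoc)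
    then show False using f by simp
  qed
  moreover have "e * x - x \<in> ?R" for x
    using e by (simp add: right_diff_distrib flip: mult.assoc)
  ultimately have "e * x - x = 0" for x by blast
  then show ?thesis by (auto intro!: exI[of _ e])
qed

lemma unit_exists: "\<exists>u. \<forall>x::'a. u * x = x \<and> x * u = x"
proof -
  obtain u where u: "\<And>x::'a. u * x = x" using left_unit_exists by blast
  have "x * u - x = 0" for x :: 'a
    by (rule left_annihilator_trivial) (simp add: left_diff_distrib mult.assoc u)
  then show ?thesis using u by (auto intro!: exI[of _ u])
qed

end

section \<open>Multiplication operators over the center\<close>

text \<open>The corner \<open>e * A * e\<close> is a division ring with unit \<open>e\<close>.
  Membership of \<open>x\<close> in the corner is expressed by \<open>e * x = x\<close> and
  \<open>x * e = x\<close>.\<close>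

definition division_idempotent :: "'a::ring \<Rightarrow> bool" where
  "division_idempotent e \<longleftrightarrow> e \<noteq> 0 \<and> e * e = e \<and>
     (\<forall>x. x \<noteq> 0 \<and> e * x = x \<and> x * e = x \<longrightarrow>
       (\<exists>y. e * y = y \<and> y * e = y \<and> x * y = e \<and> y * x = e))"

definition center :: "'a::ring set" where
  "center = {k. \<forall>x. k * x = x * k}"

lemma center_commute: "k \<in> center \<Longrightarrow> k * x = x * k"
  by (simp add: center_def)

lemma center_left_commute: "k \<in> center \<Longrightarrow> x * (k * y) = k * (x * y)"
  by (metis center_commute mult.assoc)

lemma center_0 [simp]: "0 \<in> center"
  by (simp add: center_def)

lemma center_add: "k \<in> center \<Longrightarrow> l \<in> center \<Longrightarrow> k + l \<in> center"
  by (simp add: center_def algebra_simps)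

lemma center_uminus: "k \<in> center \<Longrightarrow> - k \<in> center"
  by (simp add: center_def)

lemma center_diff: "k \<in> center \<Longrightarrow> l \<in> center \<Longrightarrow> k - l \<in> center"
  by (simp add: center_def algebra_simps)

lemma center_mult:
  assumes "k \<in> center" "l \<in> center"
  shows "k * l \<in> center"
proof -
  have "k * l * x = x * (k * l)" for x
  proof -
    have "k * l * x = k * (x * l)"
      using center_commute[OF assms(2), of x] by (simp add: mult.assoc)
    also have "\<dots> = x * (k * l)"
      using center_commute[OF assms(1), of x] by (simp flip: mult.assoc)
    finally show ?thesis .
  qed
  then show ?thesis by (simp add: center_def)
qed

text \<open>For unital \<open>A\<close> this is the multiplication algebra, the image of the tensor
  product of \<open>A\<close> with its opposite. Scalars are absorbed into the factors
  \<open>a\<close> and \<open>b\<close>.\<close>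

inductive_set multiplications :: "('a::ring \<Rightarrow> 'a) set" where
  elementary: "(\<lambda>x. a * x * b) \<in> multiplications"
| add: "f \<in> multiplications \<Longrightarrow> g \<in> multiplications \<Longrightarrow> (\<lambda>x. f x + g x) \<in> multiplications"

lemma multiplications_mult:
  assumes "f \<in> multiplications"
  shows "(\<lambda>x. a * f x * b) \<in> multiplications"
  using assms
proof induction
  case (elementary c d)
  have "(\<lambda>x. a * (c * x * d) * b) = (\<lambda>x. (a * c) * x * (d * b))"
    by (simp add: mult.assoc)
  then show ?case by (simp only: multiplications.elementary)
next
  case (add f g)
  then show ?case
    using multiplications.add[OF add.IH] by (simp add: distrib_left distrib_right)
qed

lemma multiplications_comp:
  assumes "f \<in> multiplications" "g \<in> multiplications"
  shows "(\<lambda>x. f (g x)) \<in> multiplications"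
  using assms
  by induction (auto intro: multiplications_mult multiplications.add)

lemma multiplications_uminus:
  assumes "f \<in> multiplications"
  shows "(\<lambda>x. - f x) \<in> multiplications"
  using assms
proof induction
  case (elementary a b)
  show ?case using multiplications.elementary[of "- a" b] by simp
next
  case (add f g)
  then show ?case using multiplications.add[OF add.IH] by (simp add: add.commute)
qed

lemma multiplications_diff:
  "f \<in> multiplications \<Longrightarrow> g \<in> multiplications \<Longrightarrow> (\<lambda>x. f x - g x) \<in> multiplications"
  using multiplications.add[OF _ multiplications_uminus, of f g] by simp

lemma multiplications_additive:
  assumes "f \<in> multiplications"
  shows "f (x + y) = f x + f y"
  using assms by induction (auto simp: algebra_simps)

lemma multiplications_zero: "f \<in> multiplications \<Longrightarrow> f 0 = 0"
  by (induction rule: multiplications.induct) auto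

lemma multiplications_sum:
  assumes "f \<in> multiplications"
  obtains n :: nat and a b where "f = (\<lambda>x. \<Sum>i<n. a i * x * b i)"
proof -
  have "\<exists>(n::nat) a b. f = (\<lambda>x. \<Sum>i<n. a i * x * b i)"
    using assms
  proof induction
    case (elementary a b)
    show ?case
      by (rule exI[of _ 1], rule exI[of _ "\<lambda>_. a"], rule exI[of _ "\<lambda>_. b"]) simp
  next
    case (add f g)
    then obtain n m :: nat and a b c d
      where f: "f = (\<lambda>x. \<Sum>i<n. a i * x * b i)" and g: "g = (\<lambda>x. \<Sum>i<m. c i * x * d i)"
      by blast
    let ?a = "\<lambda>i. if i < n then a i else c (i - n)"
    let ?b = "\<lambda>i. if i < n then b i else d (i - n)"
    have split: "sum h {..<n + m} = sum h {..<n} + (\<Sum>i<m. h (n + i))" for h :: "nat \<Rightarrow> 'a"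
      by (induction m) (simp_all add: add.assoc)
    have "(\<lambda>x. f x + g x) = (\<lambda>x. \<Sum>i<n + m. ?a i * x * ?b i)"
      by (simp add: f g split)
    then show ?case by (intro exI)
  qed
  then show ?thesis using that by blast
qed

locale unital_simple_algebra = fd_simple_algebra scale Basis
  for scale :: "'f::field \<Rightarrow> 'a::ring \<Rightarrow> 'a" and Basis +
  fixes u :: 'a
  assumes u_left [simp]: "u * x = x" and u_right [simp]: "x * u = x"
begin

lemma u_nonzero: "u \<noteq> 0"
  using mult_nontrivial by (metis u_left mult_zero_left)

lemma u_center [simp]: "u \<in> center"
  by (simp add: center_def)

lemma scale_u_center [simp]: "scale c u \<in> center"
  by (simp add: center_def scale_mult_left scale_mult_right)

text \<open>The center is a field: \<open>k * A\<close> is a nonzero two-sided ideal, hence contains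
  \<open>u\<close>.\<close>

lemma center_inverse:
  assumes "k \<in> center" "k \<noteq> 0"
  obtains l where "l \<in> center" "l * k = u" "k * l = u"
proof -
  have "range ((*) k) = {0} \<or> range ((*) k) = UNIV"
  proof (rule simple)
    show "subspace (range ((*) k))"
      using right_ideal_range by (simp add: right_ideal_def)
    show "x * a \<in> range ((*) k)" if "a \<in> range ((*) k)" for a x
      using that assms by (auto simp: center_left_commute)
    show "a * x \<in> range ((*) k)" if "a \<in> range ((*) k)" for a x
      using that by (auto simp: mult.assoc)
  qed
  moreover have "k \<in> range ((*) k)" by (metis u_right rangeI)
  ultimately obtain l where l: "k * l = u" using assms by (metis UNIV_I empty_iff imageE insertE)
  have "l * x = x * l" for x
  proof -
    have "l * x = l * (x * k) * l" using l by (simp add: mult.assoc)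
    also have "\<dots> = (k * l) * x * l" using assms by (metis center_commute mult.assoc)
    finally show ?thesis using l by simp
  qed
  then have "l \<in> center" by (simp add: center_def)
  then show ?thesis using that l by (metis center_commute)
qed

lemma multiplications_scale:
  "f \<in> multiplications \<Longrightarrow> f (scale c x) = scale c (f x)"
  by (induction rule: multiplications.induct)
    (auto simp: scale_mult_left scale_mult_right scale_right_distrib)

text \<open>The values \<open>m a\<close> form the two-sided ideal generated by
  \<open>a\<close>.\<close>

lemma multiplications_transitive:
  fixes a b :: 'a
  assumes "a \<noteq> 0"
  obtains m where "m \<in> multiplications" "m a = b"
proof -
  let ?I = "(\<lambda>m. m a) ` multiplications"
  have "?I = {0} \<or> ?I = UNIV"
  proof (rule simple)
    show "subspace ?I"
    proof (rule subspaceI)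
      show "0 \<in> ?I" using multiplications.elementary[of 0 0] by (rule rev_image_eqI) simp
      show "x + y \<in> ?I" if "x \<in> ?I" "y \<in> ?I" for x y
        using that by (auto intro: multiplications.add rev_image_eqI)
      show "scale c x \<in> ?I" if x: "x \<in> ?I" for c x
      proof -
        obtain m where m: "m \<in> multiplications" "x = m a" using x by blast
        show ?thesis
          by (rule rev_image_eqI[OF multiplications_mult[OF m(1), of "scale c u" u]])
            (simp add: m scale_mult_left)
      qed
    qed
    show "x * y \<in> ?I" if y: "y \<in> ?I" for x y
    proof -
      obtain m where m: "m \<in> multiplications" "y = m a" using y by blast
      show ?thesis
        by (rule rev_image_eqI[OF multiplications_mult[OF m(1), of x u]]) (simp add: m)
    qed
    show "y * x \<in> ?I" if y: "y \<in> ?I" for x y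
    proof -
      obtain m where m: "m \<in> multiplications" "y = m a" using y by blast
      show ?thesis
        by (rule rev_image_eqI[OF multiplications_mult[OF m(1), of u x]]) (simp add: m)
    qed
  qed
  moreover have "a \<in> ?I"
    using multiplications.elementary[of u u] by (rule rev_image_eqI) simp
  ultimately have "b \<in> ?I" using assms by blast
  then show ?thesis using that by blast
qed

text \<open>The hypothesis passes from \<open>b\<close> to all \<open>m b\<close>, that is, to every
  element of \<open>A\<close>, so \<open>a\<close> annihilates \<open>A\<close>.\<close>

lemma prime:
  fixes a b :: 'a
  assumes "\<And>x. a * x * b = 0"
  shows "a = 0 \<or> b = 0"
proof (rule disjCI)
  assume "b \<noteq> 0"
  show "a = 0"
  proof (rule left_annihilator_trivial)
    fix x
    obtain m where m: "m \<in> multiplications" "m b = x"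
      using multiplications_transitive[OF \<open>b \<noteq> 0\<close>] by blast
    have "a * y * m b = 0" for y
      using m(1)
    proof (induction arbitrary: y)
      case (elementary c d)
      have "a * y * (c * b * d) = (a * (y * c) * b) * d" by (simp add: mult.assoc)
      then show ?case by (simp add: assms)
    qed (simp add: distrib_left)
    from this[of u] show "a * x = 0" using m by simp
  qed
qed

text \<open>This is the core of the tensor product identification, proved by shortening the
  relation. After normalizing the coefficient at \<open>j\<close> to \<open>u\<close>, either all
  coefficients are central and \<open>x = u\<close> gives the dependence, or a commutator removes
  index \<open>j\<close> without killing the relation.\<close>

lemma center_dependent:
  fixes a b :: "'i \<Rightarrow> 'a"
  assumes "finite I" "\<And>x. (\<Sum>i\<in>I. a i * x * b i) = 0" "j \<in> I" "a j \<noteq> 0"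
  obtains k where "\<And>i. i \<in> I \<Longrightarrow> k i \<in> center" "\<exists>i\<in>I. k i \<noteq> 0" "(\<Sum>i\<in>I. k i * b i) = 0"
proof -
  have "\<exists>k. (\<forall>i\<in>I. k i \<in> center) \<and> (\<exists>i\<in>I. k i \<noteq> 0) \<and> (\<Sum>i\<in>I. k i * b i) = 0"
    using assms
  proof (induction arbitrary: a j rule: finite_psubset_induct)
    case (psubset I)
    obtain m where m: "m \<in> multiplications" "m (a j) = u"
      using multiplications_transitive[OF psubset.prems(3)] by blast
    have rel: "(\<Sum>i\<in>I. f (a i) * x * b i) = 0" if "f \<in> multiplications" for f x
      using that
    proof (induction arbitrary: x)
      case (elementary c d)
      have "(\<Sum>i\<in>I. c * a i * d * x * b i) = c * (\<Sum>i\<in>I. a i * (d * x) * b i)"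
        by (simp add: sum_distrib_left mult.assoc)
      then show ?case by (simp add: psubset.prems(1))
    qed (simp add: distrib_right sum.distrib)
    show ?case
    proof (cases "\<forall>i\<in>I. m (a i) \<in> center")
      case True
      then show ?thesis
        using rel[OF m(1), of u] m(2) u_nonzero psubset.prems(2)
        by (intro exI[of _ "\<lambda>i. m (a i)"]) auto
    next
      case False
      then obtain l where "l \<in> I" "m (a l) \<notin> center" by blast
      moreover from this obtain y where "m (a l) * y \<noteq> y * m (a l)"
        unfolding center_def by blast
      ultimately have l: "l \<in> I" "y * m (a l) - m (a l) * y \<noteq> 0" by simp_all
      \<comment> \<open>Commuting with \<open>y\<close> kills the normalized coefficient
        \<open>u\<close> at \<open>j\<close> but not the noncentral one at \<open>l\<close>.\<close>
      define f where "f x = y * m x - m x * y" for x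
      have f: "f \<in> multiplications"
        using multiplications_diff[OF multiplications_mult[OF m(1), of y u]
            multiplications_mult[OF m(1), of u y]]
        by (simp add: f_def[abs_def])
      have fj: "f (a j) = 0" by (simp add: f_def m)
      have "(\<Sum>i\<in>I - {j}. f (a i) * x * b i) = 0" for x
        using rel[OF f, of x] fj psubset.hyps psubset.prems(2)
        by (simp add: sum.remove[of I j])
      moreover have "l \<in> I - {j}" using l fj by (auto simp: f_def)
      moreover have "I - {j} \<subset> I" using psubset.prems(2) by blast
      ultimately obtain k where k: "\<forall>i\<in>I - {j}. k i \<in> center" "\<exists>i\<in>I - {j}. k i \<noteq> 0"
        "(\<Sum>i\<in>I - {j}. k i * b i) = 0"
        using psubset.IH[of "I - {j}" "\<lambda>i. f (a i)" l] l by (auto simp: f_def)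
      have "(\<Sum>i\<in>I. (k(j := 0)) i * b i) = (\<Sum>i\<in>I - {j}. k i * b i)"
        using psubset.hyps psubset.prems(2) by (simp add: sum.remove[of I j])
      then show ?thesis using k by (intro exI[of _ "k(j := 0)"]) auto
    qed
  qed
  then show ?thesis using that by blast
qed

text \<open>This says that \<open>a \<otimes> b \<mapsto> b \<otimes> a\<close> is well defined on multiplication operators;
  it rests on their identification with a tensor product over the center.\<close>
lemma swap_relation:
  fixes a b :: "'i \<Rightarrow> 'a"
  assumes "finite I" "\<And>x. (\<Sum>i\<in>I. a i * x * b i) = 0"
  shows "(\<Sum>i\<in>I. b i * x * a i) = 0"
  using assms
proof (induction arbitrary: a rule: finite_psubset_induct)
  case (psubset I)
  show ?case
  proof (cases "\<forall>i\<in>I. a i = 0")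
    case False
    then obtain i where "i \<in> I" "a i \<noteq> 0" by blast
    then obtain k where k: "\<And>i. i \<in> I \<Longrightarrow> k i \<in> center" "\<exists>i\<in>I. k i \<noteq> 0"
      "(\<Sum>i\<in>I. k i * b i) = 0"
      using center_dependent[OF psubset.hyps psubset.prems] by blast
    then obtain j where "j \<in> I" "k j \<noteq> 0" by blast
    moreover from this obtain l where "l \<in> center" "l * k j = u"
      using center_inverse[OF k(1)] by blast
    ultimately have j: "j \<in> I" "l \<in> center" "l * k j = u" by simp_all
    define c where "c i = l * k i" for i
    have c: "c i \<in> center" if "i \<in> I" for i
      using that k(1) j by (simp add: c_def center_mult)
    have "l * (\<Sum>i\<in>I. k i * b i) = (\<Sum>i\<in>I. c i * b i)"
      by (simp add: sum_distrib_left c_def mult.assoc)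
    then have "b j + (\<Sum>i\<in>I - {j}. c i * b i) = 0"
      using k(3) j psubset.hyps by (simp add: sum.remove[of I j] c_def)
    then have bj: "b j = - (\<Sum>i\<in>I - {j}. c i * b i)" by (rule eq_neg_iff_add_eq_0[THEN iffD2])
    \<comment> \<open>Eliminating \<open>b j\<close> gives the same new coefficients on either side
      of \<open>x\<close>, so the induction hypothesis carries the swap over.\<close>
    have 1: "(\<Sum>i\<in>I. a i * x * b i) = (\<Sum>i\<in>I - {j}. (a i - c i * a j) * x * b i)" for x
    proof -
      have "(\<Sum>i\<in>I. a i * x * b i) = a j * x * b j + (\<Sum>i\<in>I - {j}. a i * x * b i)"
        using j psubset.hyps by (simp add: sum.remove[of I j])
      also have "a j * x * b j = - (\<Sum>i\<in>I - {j}. c i * a j * x * b i)"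
        using center_left_commute[OF c, of _ "a j * x"]
        unfolding bj by (simp add: sum_distrib_left mult.assoc)
      finally show ?thesis by (simp add: sum_subtractf algebra_simps)
    qed
    have 2: "(\<Sum>i\<in>I. b i * x * a i) = (\<Sum>i\<in>I - {j}. b i * x * (a i - c i * a j))" for x
    proof -
      have "(\<Sum>i\<in>I. b i * x * a i) = b j * x * a j + (\<Sum>i\<in>I - {j}. b i * x * a i)"
        using j psubset.hyps by (simp add: sum.remove[of I j])
      also have "b j * x * a j = - (\<Sum>i\<in>I - {j}. c i * (b i * x * a j))"
        unfolding bj by (simp add: sum_distrib_right mult.assoc)
      also have "(\<Sum>i\<in>I - {j}. c i * (b i * x * a j)) = (\<Sum>i\<in>I - {j}. b i * x * (c i * a j))"
        by (intro sum.cong) (simp_all add: c center_left_commute[of "c _"])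
      finally show ?thesis by (simp add: sum_subtractf algebra_simps)
    qed
    show ?thesis
      unfolding 2 using j psubset.prems 1 by (intro psubset.IH) auto
  qed simp
qed

lemma subspace_kernel:
  assumes "f \<in> multiplications"
  shows "subspace {x. f x = 0}"
  using assms
  by (auto simp: subspace_def multiplications_additive multiplications_scale multiplications_zero)

text \<open>Take a nonzero multiplication \<open>E\<close> with kernel of largest dimension and
  normalize a value of it to \<open>u\<close>. A commutator with \<open>z\<close> kills that value
  and therefore, by maximality, all values.\<close>

lemma central_multiplication_exists:
  obtains E :: "'a \<Rightarrow> 'a" and x
  where "E \<in> multiplications" "E x \<noteq> 0" "\<And>y. E y \<in> center"
proof -
  let ?P = "\<lambda>E::'a \<Rightarrow> 'a. E \<in> multiplications \<and> (\<exists>x. E x \<noteq> 0)"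
  let ?d = "\<lambda>E. dim {x. E x = 0}"
  have "?P (\<lambda>x. u * x * u)"
    using multiplications.elementary[of u u] u_nonzero by auto
  then have "\<exists>E. ?P E \<and> (\<forall>g. ?P g \<longrightarrow> ?d g \<le> ?d E)"
    by (rule ex_has_greatest_nat[of ?P _ ?d "Suc dimension"])
      (auto simp: le_imp_less_Suc dim_subset_UNIV)
  then obtain E where E: "E \<in> multiplications" "\<exists>x. E x \<noteq> 0"
    and max: "\<And>g. ?P g \<Longrightarrow> ?d g \<le> ?d E" by blast
  then obtain x where x: "E x \<noteq> 0" by blast
  \<comment> \<open>Otherwise \<open>m\<close> after \<open>E\<close> would be nonzero with a kernel
    strictly larger than that of \<open>E\<close>, as it also contains \<open>x\<close>.\<close>
  have kernel: "m (E y) = 0" if m: "m \<in> multiplications" "m (E x) = 0" for m y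
  proof (rule ccontr)
    assume "m (E y) \<noteq> 0"
    then have P: "?P (\<lambda>x. m (E x))"
      using multiplications_comp[OF m(1) E(1)] by blast
    have "{x. E x = 0} = {x. m (E x) = 0}"
    proof (rule subspace_dim_equal)
      show "{x. E x = 0} \<subseteq> {x. m (E x) = 0}" using multiplications_zero[OF m(1)] by auto
    qed (use P max[OF P] E subspace_kernel in auto)
    then show False using x m by blast
  qed
  obtain m where m: "m \<in> multiplications" "m (E x) = u"
    using multiplications_transitive[OF x] by blast
  have "m (E y) \<in> center" for y
  proof -
    have "z * m (E y) = m (E y) * z" for z
    proof -
      let ?f = "\<lambda>x. z * m x * u - u * m x * z"
      have "?f \<in> multiplications"
        using m by (intro multiplications_diff multiplications_mult)
      then show ?thesis using kernel[of ?f] m by simp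
    qed
    then show ?thesis by (simp add: center_def)
  qed
  then show ?thesis
    using that[of "\<lambda>x. m (E x)" x] m u_nonzero multiplications_comp[OF m(1) E(1)] by simp
qed

section \<open>The space of sums of commutators\<close>

definition commutators :: "'a set" where
  "commutators = span {x * y - y * x | x y. True}"

lemma subspace_commutators: "subspace commutators"
  by (simp add: commutators_def)

lemma commutator_mem: "x * y - y * x \<in> commutators"
  unfolding commutators_def by (rule span_base) blast

lemma commutators_subset:
  assumes "subspace S" "\<And>x y. x * y - y * x \<in> S"
  shows "commutators \<subseteq> S"
  unfolding commutators_def using assms by (intro span_minimal) auto

lemma commutators_center_mult:
  assumes "k \<in> center" "x \<in> commutators"
  shows "k * x \<in> commutators"
proof -
  have "commutators \<subseteq> {x. k * x \<in> commutators}"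
  proof (rule commutators_subset)
    show "subspace {x. k * x \<in> commutators}"
      using subspace_commutators
      by (auto simp: subspace_def distrib_left scale_mult_right)
    show "x * y - y * x \<in> {x. k * x \<in> commutators}" for x y
      using commutator_mem[of "k * x" y] assms
      by (simp add: right_diff_distrib mult.assoc center_left_commute)
  qed
  then show ?thesis using assms by blast
qed

text \<open>If \<open>E x = (\<Sum>i. a i * x * b i)\<close> is central-valued, then
  \<open>\<Sum>i. y * a i \<otimes> b i = \<Sum>i. a i \<otimes> b i * y\<close>, and swapping the tensor factors shows that
  \<open>x \<mapsto> \<Sum>i. b i * x * a i\<close> vanishes on commutators.\<close>
lemma commutators_proper: "commutators \<noteq> UNIV"
proof
  assume all: "commutators = UNIV"
  obtain E :: "'a \<Rightarrow> 'a" and z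
    where E: "E \<in> multiplications" "E z \<noteq> 0" "\<And>y. E y \<in> center"
    by (rule central_multiplication_exists) blast
  obtain n :: nat and a b where sum: "E = (\<lambda>x. \<Sum>i<n. a i * x * b i)"
    using multiplications_sum[OF E(1)] by blast
  define t where "t x = (\<Sum>i<n. b i * x * a i)" for x
  have t: "t (x * y) = t (y * x)" for x y
  proof -
    \<comment> \<open>The disjoint union writes \<open>y * E x - E x * y\<close> as one sum of
      products, the form required by \<open>swap_relation\<close>.\<close>
    let ?I = "{..<n} <+> {..<n}"
    have "(\<Sum>i\<in>?I. (case i of Inl i \<Rightarrow> y * a i | Inr i \<Rightarrow> - a i) * x *
        (case i of Inl i \<Rightarrow> b i | Inr i \<Rightarrow> b i * y)) = y * E x - E x * y" for x
      by (simp add: sum.Plus sum sum_distrib_left sum_distrib_right mult.assoc sum_negf)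
    also have "y * E x - E x * y = 0" for x
      by (simp add: center_commute[OF E(3)])
    finally have "(\<Sum>i\<in>?I. (case i of Inl i \<Rightarrow> b i | Inr i \<Rightarrow> b i * y) * x *
        (case i of Inl i \<Rightarrow> y * a i | Inr i \<Rightarrow> - a i)) = 0"
      by (rule swap_relation[rotated]) simp
    then show ?thesis
      by (simp add: sum.Plus t_def sum_negf mult.assoc)
  qed
  have "commutators \<subseteq> {x. t x = 0}"
  proof (rule commutators_subset)
    show "subspace {x. t x = 0}"
      by (auto simp: subspace_def t_def distrib_left distrib_right sum.distrib
          scale_mult_left scale_mult_right simp flip: scale_sum_right)
    have "t (x - y) = t x - t y" for x y
      by (simp add: t_def left_diff_distrib right_diff_distrib sum_subtractf)
    then show "x * y - y * x \<in> {x. t x = 0}" for x y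
      using t[of x y] by simp
  qed
  \<comment> \<open>Swapping back turns the vanishing of \<open>t\<close> into the vanishing of
    \<open>E\<close>.\<close>
  then have t0: "(\<Sum>i<n. b i * x * a i) = 0" for x
    using all by (auto simp: t_def)
  have "(\<Sum>i<n. a i * x * b i) = 0" for x
    by (rule swap_relation[OF _ t0]) simp
  then show False using E(2) sum by simp
qed

text \<open>For \<open>M = e * A\<close> minimal, a nonzero corner element \<open>x\<close>
  satisfies \<open>x * A = e * A\<close>, hence has a right inverse in the corner. Right inverses
  for all nonzero corner elements are automatically two-sided.\<close>

lemma division_idempotent_exists:
  obtains e :: 'a where "division_idempotent e"
proof -
  have "right_ideal UNIV" by (simp add: right_ideal_def)
  moreover have "(UNIV :: 'a set) \<noteq> {0}" using u_nonzero by blast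
  ultimately obtain M where M: "minimal_right_ideal M"
    using minimal_right_ideal_exists by blast
  then obtain e where e: "e \<noteq> 0" "e * e = e" "M = range ((*) e)"
    using minimal_right_ideal_idempotent by blast
  have right_inverse: "\<exists>y. e * y = y \<and> y * e = y \<and> x * y = e"
    if x: "x \<noteq> 0" "e * x = x" "x * e = x" for x
  proof -
    have "range ((*) x) \<subseteq> M"
    proof
      fix z assume "z \<in> range ((*) x)"
      then obtain y where "z = e * (x * y)" using x by (metis imageE mult.assoc)
      then show "z \<in> M" using e by blast
    qed
    moreover have "x \<in> range ((*) x)" using x by (metis rangeI)
    ultimately have "range ((*) x) = M"
      using M x right_ideal_range[of x] unfolding minimal_right_ideal_def by blast
    moreover have "e \<in> M" using e by (metis rangeI)
    ultimately obtain z where "e = x * z" by blast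
    then have "x * (e * z * e) = e" using x e by (simp flip: mult.assoc)
    moreover have "e * (e * z * e) = e * z * e" "e * z * e * e = e * z * e"
      using e by (simp_all add: mult.assoc) (simp flip: mult.assoc)
    ultimately show ?thesis by blast
  qed
  have "\<exists>y. e * y = y \<and> y * e = y \<and> x * y = e \<and> y * x = e"
    if x: "x \<noteq> 0 \<and> e * x = x \<and> x * e = x" for x
  proof -
    obtain y where y: "e * y = y" "y * e = y" "x * y = e" using right_inverse x by blast
    then have "y \<noteq> 0" using e by auto
    then obtain w where w: "e * w = w" "y * w = e" using right_inverse y by blast
    have "w = x * y * w" using y w by simp
    then have "w = x" using w x by (simp add: mult.assoc)
    then show ?thesis using y w by blast
  qed
  then have "division_idempotent e" using e by (simp add: division_idempotent_def)
  then show ?thesis using that by blast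
qed

text \<open>Primeness provides a nonzero element \<open>w * a * f\<close> of the corner of
  \<open>f\<close>, which is invertible there.\<close>

lemma division_idempotent_right_inverse:
  fixes f w :: 'a
  assumes f: "division_idempotent f" and w: "w \<noteq> 0" "f * w = w"
  obtains v where "w * v = f"
proof -
  obtain a where a: "w * a * f \<noteq> 0"
    using prime[of w f] f w by (auto simp: division_idempotent_def)
  have "f * (w * a * f) = w * a * f" "w * a * f * f = w * a * f"
    using f w by (simp_all add: division_idempotent_def mult.assoc) (simp flip: mult.assoc)
  then obtain y where "w * a * f * y = f"
    using a f by (auto simp: division_idempotent_def)
  then show ?thesis using that[of "a * f * y"] by (simp add: mult.assoc)
qed

text \<open>Every \<open>x\<close> is a sum of terms \<open>a * e * b\<close>, and
  \<open>a * e * b\<close> is congruent to \<open>e * b * a * e\<close> modulo commutators.\<close>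

lemma corner_representative:
  fixes e x :: 'a
  assumes e: "division_idempotent e"
  obtains y where "e * y = y" "y * e = y" "x - y \<in> commutators"
proof -
  have ee: "e * e = e" "e \<noteq> 0" using e by (auto simp: division_idempotent_def)
  have "\<exists>y. e * y = y \<and> y * e = y \<and> m e - y \<in> commutators" if "m \<in> multiplications" for m
    using that
  proof induction
    case (elementary a b)
    have "a * e * b - e * b * a * e = (a * e) * (e * b) - (e * b) * (a * e)"
      by (simp add: mult.assoc) (simp add: ee flip: mult.assoc)
    then have "a * e * b - e * b * a * e \<in> commutators"
      using commutator_mem by metis
    then show ?case
      by (intro exI[of _ "e * b * a * e"]) (simp add: mult.assoc ee, simp add: ee flip: mult.assoc)
  next
    case (add f g)
    then obtain y z where y: "e * y = y" "y * e = y" "f e - y \<in> commutators"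
      and z: "e * z = z" "z * e = z" "g e - z \<in> commutators"
      by blast
    have "(f e + g e) - (y + z) \<in> commutators"
      using subspace_add[OF subspace_commutators y(3) z(3)] by (simp add: algebra_simps)
    then show ?case using y z by (intro exI[of _ "y + z"]) (simp add: algebra_simps)
  qed
  then show ?thesis using multiplications_transitive[OF ee(2), of x] that by metis
qed

section \<open>Minimal polynomials over the center and central linear systems\<close>

definition corner_power :: "'a \<Rightarrow> 'a \<Rightarrow> nat \<Rightarrow> 'a" where
  "corner_power e x n = (((*) x) ^^ n) e"

lemma corner_power_0 [simp]: "corner_power e x 0 = e"
  and corner_power_Suc: "corner_power e x (Suc n) = x * corner_power e x n"
  by (simp_all add: corner_power_def)

lemma corner_power_commute:
  assumes "e * x = x" "x * e = x"
  shows "corner_power e x n * x = x * corner_power e x n"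
  using assms by (induction n) (simp_all add: corner_power_Suc mult.assoc)

lemma corner_power_closed:
  assumes "e * e = e" "e * x = x" "x * e = x"
  shows "e * corner_power e x n = corner_power e x n" "corner_power e x n * e = corner_power e x n"
proof -
  show "corner_power e x n * e = corner_power e x n"
    using assms by (induction n) (simp_all add: corner_power_Suc mult.assoc)
  show "e * corner_power e x n = corner_power e x n"
    using assms by (cases n) (simp_all add: corner_power_Suc flip: mult.assoc)
qed

lemma in_span_image_lessThan:
  assumes "v \<in> span (g ` {..<n::nat})"
  obtains c where "v = (\<Sum>i<n. scale (c i) (g i))"
proof -
  have "span (g ` {..<n}) \<subseteq> {v. \<exists>c. v = (\<Sum>i<n. scale (c i) (g i))}"
  proof (rule span_minimal)
    show "g ` {..<n} \<subseteq> {v. \<exists>c. v = (\<Sum>i<n. scale (c i) (g i))}"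
    proof safe
      fix j assume "j < n"
      then have "(\<Sum>i<n. scale (if i = j then 1 else 0) (g i)) = g j"
        by (simp add: if_distrib[of "\<lambda>c. scale c _"] sum.delta cong: if_cong)
      then show "\<exists>c. g j = (\<Sum>i<n. scale (c i) (g i))" by metis
    qed
    show "subspace {v. \<exists>c. v = (\<Sum>i<n. scale (c i) (g i))}"
    proof (rule subspaceI; safe)
      show "\<exists>c. 0 = (\<Sum>i<n. scale (c i) (g i))" by (rule exI[of _ "\<lambda>_. 0"]) simp
      show "\<exists>c. (\<Sum>i<n. scale (a i) (g i)) + (\<Sum>i<n. scale (b i) (g i)) =
          (\<Sum>i<n. scale (c i) (g i))" for a b
        by (rule exI[of _ "\<lambda>i. a i + b i"]) (simp add: scale_left_distrib sum.distrib)
      show "\<exists>b. scale c (\<Sum>i<n. scale (a i) (g i)) = (\<Sum>i<n. scale (b i) (g i))" for a c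
        by (rule exI[of _ "\<lambda>i. c * a i"]) (simp add: scale_sum_right)
    qed
  qed
  then show ?thesis using assms that by blast
qed

lemma sequence_dependent: "\<exists>n. g n \<in> span (g ` {..<n::nat})"
proof (rule ccontr)
  assume neg: "\<not> ?thesis"
  have "independent (g ` {..<n}) \<and> card (g ` {..<n}) = n" for n
  proof (induction n)
    case (Suc n)
    have new: "g n \<notin> span (g ` {..<n})" using neg by blast
    then have "g n \<notin> g ` {..<n}" by (rule contrapos_nn) (rule span_base)
    then show ?case
      using Suc independent_insertI[OF new] by (simp add: lessThan_Suc)
  qed (simp add: independent_empty)
  from this[of "Suc dimension"] show False
    using independent_card_le_dim[of "g ` {..<Suc dimension}" UNIV] dim_subset_UNIV[of UNIV]
    by (metis Suc_n_not_le_n le_trans subset_UNIV)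
qed

text \<open>A dependence over \<open>F\<close> is one over the center through
  \<open>scale c u\<close>, so a least degree \<open>d\<close> exists. Minimality is recorded as
  independence of the lower powers, obtained by dividing a relation by its highest nonzero
  coefficient.\<close>

lemma minimal_polynomial:
  obtains d k where "\<And>i. i < d \<Longrightarrow> k i \<in> center"
    "corner_power e x d = (\<Sum>i<d. k i * corner_power e x i)"
    "\<And>l j. \<lbrakk>\<And>i. i < d \<Longrightarrow> l i \<in> center; (\<Sum>i<d. l i * corner_power e x i) = 0; j < d\<rbrakk>
      \<Longrightarrow> l j = 0"
proof -
  let ?P = "\<lambda>d. \<exists>k. (\<forall>i<d. k i \<in> center) \<and>
    corner_power e x d = (\<Sum>i<d. k i * corner_power e x i)"
  obtain n where n: "corner_power e x n \<in> span (corner_power e x ` {..<n})"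
    using sequence_dependent by blast
  have "?P n"
  proof -
    obtain c where "corner_power e x n = (\<Sum>i<n. scale (c i) (corner_power e x i))"
      using in_span_image_lessThan[OF n] by blast
    then show ?thesis
      by (intro exI[of _ "\<lambda>i. scale (c i) u"]) (simp add: scale_mult_left)
  qed
  define d where "d = (LEAST d. ?P d)"
  have "?P d" unfolding d_def by (rule LeastI[of ?P]) fact
  then obtain k where k: "\<forall>i<d. k i \<in> center"
    "corner_power e x d = (\<Sum>i<d. k i * corner_power e x i)" by blast
  have least: "\<not> ?P m" if "m < d" for m
    using that unfolding d_def by (rule not_less_Least)
  have "l j = 0" if l: "\<And>i. i < d \<Longrightarrow> l i \<in> center" "(\<Sum>i<d. l i * corner_power e x i) = 0" "j < d"
    for l j
  proof (rule ccontr)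
    assume "l j \<noteq> 0"
    let ?S = "{j. j < d \<and> l j \<noteq> 0}"
    define m where "m = Max ?S"
    have "m \<in> ?S" unfolding m_def using \<open>l j \<noteq> 0\<close> \<open>j < d\<close> by (intro Max_in) auto
    then have m: "m < d" "l m \<noteq> 0" by auto
    have big: "l i = 0" if "i < d" "m < i" for i
    proof (rule ccontr)
      assume "l i \<noteq> 0"
      then have "i \<le> m" unfolding m_def using that by (intro Max_ge) auto
      then show False using that by simp
    qed
    have "(\<Sum>i<d. l i * corner_power e x i) = (\<Sum>i<Suc m. l i * corner_power e x i)"
      using m big by (intro sum.mono_neutral_right) auto
    then have 0: "(\<Sum>i<m. l i * corner_power e x i) + l m * corner_power e x m = 0"
      using l(2) by simp
    obtain h where h: "h \<in> center" "h * l m = u"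
      using center_inverse[OF l(1)[OF m(1)] m(2)] by blast
    have "h * ((\<Sum>i<m. l i * corner_power e x i) + l m * corner_power e x m)
        = (\<Sum>i<m. h * l i * corner_power e x i) + corner_power e x m"
      using h by (simp add: distrib_left sum_distrib_left flip: mult.assoc)
    then have "corner_power e x m = (\<Sum>i<m. (- (h * l i)) * corner_power e x i)"
      using 0 by (simp add: sum_negf eq_neg_iff_add_eq_0 add.commute)
    moreover have "\<forall>i<m. - (h * l i) \<in> center"
      using h l(1) m by (simp add: center_mult center_uminus)
    ultimately have "?P m" by (intro exI[of _ "\<lambda>i. - (h * l i)"]) simp
    then show False using least m by blast
  qed
  then show ?thesis using that[of d k] k by blast
qed

text \<open>Gaussian elimination over the center.\<close>
lemma center_system_nontrivial:
  fixes a :: "'s \<Rightarrow> 't \<Rightarrow> 'a"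
  assumes "finite B" "finite S" "card B < card S" "\<And>s b. s \<in> S \<Longrightarrow> b \<in> B \<Longrightarrow> a s b \<in> center"
  obtains c where "\<And>s. s \<in> S \<Longrightarrow> c s \<in> center" "\<exists>s\<in>S. c s \<noteq> 0"
    "\<And>b. b \<in> B \<Longrightarrow> (\<Sum>s\<in>S. c s * a s b) = 0"
proof -
  have "\<exists>c. (\<forall>s\<in>S. c s \<in> center) \<and> (\<exists>s\<in>S. c s \<noteq> 0) \<and> (\<forall>b\<in>B. (\<Sum>s\<in>S. c s * a s b) = 0)"
    using assms
  proof (induction B arbitrary: S a rule: finite_induct)
    case empty
    then have "S \<noteq> {}" by auto
    then show ?case using u_nonzero by (intro exI[of _ "\<lambda>_. u"]) auto
  next
    case (insert b B)
    show ?case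
    proof (cases "\<forall>s\<in>S. a s b = 0")
      case True
      obtain c where "\<forall>s\<in>S. c s \<in> center" "\<exists>s\<in>S. c s \<noteq> 0"
        "\<forall>b\<in>B. (\<Sum>s\<in>S. c s * a s b) = 0"
        using insert.IH[of S a] insert.prems insert.hyps by auto
      then show ?thesis using True by (intro exI[of _ c]) auto
    next
      case False
      then obtain r where r: "r \<in> S" "a r b \<noteq> 0" by blast
      then obtain l where l: "l \<in> center" "l * a r b = u"
        using center_inverse[of "a r b"] insert.prems by blast
      define S' where "S' = S - {r}"
      \<comment> \<open>The multiplier that clears column \<open>b\<close> of row \<open>s\<close>
        by means of the pivot row \<open>r\<close>.\<close>
      define m where "m s = a s b * l" for s
      have m: "m s \<in> center" if "s \<in> S" for s
        using that l insert.prems by (simp add: m_def center_mult)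
      have S': "finite S'" "S = insert r S'" "r \<notin> S'" "card B < card S'"
        using insert.prems insert.hyps r by (auto simp: S'_def)
      obtain c where c: "\<forall>s\<in>S'. c s \<in> center" "\<exists>s\<in>S'. c s \<noteq> 0"
        "\<forall>x\<in>B. (\<Sum>s\<in>S'. c s * (a s x - m s * a r x)) = 0"
        using insert.IH[of S' "\<lambda>s x. a s x - m s * a r x"] insert.prems r S' m
        by (auto simp: center_diff center_mult)
      define c' where "c' = c(r := - (\<Sum>s\<in>S'. c s * m s))"
      have expand: "(\<Sum>s\<in>S. c' s * a s x) = (\<Sum>s\<in>S'. c s * (a s x - m s * a r x))" for x
      proof -
        have "(\<Sum>s\<in>S. c' s * a s x) = c' r * a r x + (\<Sum>s\<in>S'. c' s * a s x)"
          using S' by simp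
        also have "(\<Sum>s\<in>S'. c' s * a s x) = (\<Sum>s\<in>S'. c s * a s x)"
          using S' by (intro sum.cong) (auto simp: c'_def)
        finally show ?thesis
          by (simp add: c'_def right_diff_distrib sum_subtractf sum_distrib_right mult.assoc)
      qed
      have "(\<Sum>s\<in>S. c' s * a s b) = 0"
        unfolding expand using l by (simp add: m_def mult.assoc)
      moreover have "c' s \<in> center" if "s \<in> S" for s
      proof (cases "s = r")
        case True
        have "(\<Sum>s\<in>T. c s * m s) \<in> center" if "T \<subseteq> S'" for T
          using finite_subset[OF that S'(1)] that c(1) m S'(2)
          by (induction T rule: finite_induct) (auto intro!: center_add center_mult)
        then show ?thesis using True by (simp add: c'_def center_uminus)
      qed (use that c S' in \<open>auto simp: c'_def\<close>)
      moreover have "\<exists>s\<in>S. c' s \<noteq> 0" using c(2) S' by (auto simp: c'_def)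
      ultimately show ?thesis using c(3) by (intro exI[of _ c']) (auto simp: expand)
    qed
  qed
  then show ?thesis using that by blast
qed

end

section \<open>Jordan automorphisms\<close>

locale jordan_simple_algebra = unital_simple_algebra scale Basis u
  for scale :: "'f::field \<Rightarrow> 'a::ring \<Rightarrow> 'a" and Basis u +
  assumes char_not_2: "(2::'f) \<noteq> 0"
begin

lemma scale_two: "scale 2 x = x + x"
proof -
  have "scale 2 x = scale (1 + 1) x" by simp
  then show ?thesis by (simp only: scale_left_distrib scale_one)
qed

lemma scale_three: "scale 3 x = x + x + x"
proof -
  have "scale 3 x = scale (2 + 1) x" by simp
  then show ?thesis by (simp only: scale_left_distrib scale_one scale_two)
qed

lemma double_cancel:
  fixes x y :: 'a
  assumes "x + x = y + y" shows "x = y"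
  using assms char_not_2 by (simp flip: scale_two)

abbreviation jaut :: "('a \<Rightarrow> 'a) \<Rightarrow> bool" where
  "jaut \<equiv> jordan_automorphism scale"

lemma jaut_add: "jaut J \<Longrightarrow> J (x + y) = J x + J y"
  and jaut_scale: "jaut J \<Longrightarrow> J (scale c x) = scale c (J x)"
  by (auto simp: jordan_automorphism_def Vector_Spaces.linear_iff)

lemma jaut_bij: "jaut J \<Longrightarrow> bij J"
  and jaut_jordan: "jaut J \<Longrightarrow> J (x * y + y * x) = J x * J y + J y * J x"
  by (auto simp: jordan_automorphism_def)

lemma jaut_zero: "jaut J \<Longrightarrow> J 0 = 0"
  using jaut_add[of J 0 0] by simp

lemma jaut_uminus: "jaut J \<Longrightarrow> J (- x) = - J x"
  using jaut_add[of J x "- x"] jaut_zero[of J] by (simp add: eq_neg_iff_add_eq_0 add.commute)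

lemma jaut_diff: "jaut J \<Longrightarrow> J (x - y) = J x - J y"
  using jaut_add[of J x "- y"] jaut_uminus[of J y] by simp

lemma jaut_sum: "jaut J \<Longrightarrow> J (sum f I) = (\<Sum>i\<in>I. J (f i))"
  by (induction I rule: infinite_finite_induct) (auto simp: jaut_zero jaut_add)

lemma jaut_eq_iff: "jaut J \<Longrightarrow> J x = J y \<longleftrightarrow> x = y"
  using jaut_bij[of J] by (auto simp: bij_def inj_def)

lemma jaut_surj:
  assumes "jaut J" obtains x where "y = J x"
  using jaut_bij[OF assms] by (metis bij_pointE)

lemma jautI:
  assumes "bij J" "\<And>x y. J (x + y) = J x + J y" "\<And>c x. J (scale c x) = scale c (J x)"
    "\<And>x y. J (x * y + y * x) = J x * J y + J y * J x"
  shows "jaut J"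
  unfolding jordan_automorphism_def Vector_Spaces.linear_iff
  using assms vector_space_axioms by blast

lemma jaut_comp:
  assumes J: "jaut J" and L: "jaut L"
  shows "jaut (\<lambda>x. J (L x))"
proof (rule jautI)
  show "bij (\<lambda>x. J (L x))"
    using bij_comp[OF jaut_bij[OF L] jaut_bij[OF J]] by (simp add: o_def)
  show "J (L (x * y + y * x)) = J (L x) * J (L y) + J (L y) * J (L x)" for x y
    by (simp only: jaut_jordan[OF L] jaut_jordan[OF J])
qed (simp_all add: jaut_add jaut_scale J L)

lemma jaut_inv:
  assumes J: "jaut J" shows "jaut (inv J)"
proof -
  have inv: "inv J (J x) = x" "J (inv J x) = x" for x
    using jaut_bij[OF J] by (simp_all add: bij_is_inj bij_is_surj surj_f_inv_f)
  show ?thesis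
  proof (rule jautI)
    show "bij (inv J)" using jaut_bij[OF J] by (rule bij_imp_bij_inv)
    show "inv J (x + y) = inv J x + inv J y" for x y
      using jaut_add[OF J, of "inv J x" "inv J y"] inv by metis
    show "inv J (scale c x) = scale c (inv J x)" for c x
      using jaut_scale[OF J, of c "inv J x"] inv by metis
    show "inv J (x * y + y * x) = inv J x * inv J y + inv J y * inv J x" for x y
      using jaut_jordan[OF J, of "inv J x" "inv J y"] inv by metis
  qed
qed

section \<open>Jordan identities and Herstein's dichotomy\<close>

lemma jaut_square:
  assumes "jaut J" shows "J (x * x) = J x * J x"
  by (rule double_cancel) (use jaut_jordan[OF assms, of x x] jaut_add[OF assms] in simp)

lemma jaut_unit:
  assumes "jaut J" shows "J u = u"
proof -
  obtain x where x: "u = J x" using jaut_surj[OF assms] .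
  show ?thesis
  proof (rule double_cancel)
    have "J u + J u = J (u * x + x * u)"
      unfolding jaut_jordan[OF assms] x[symmetric] by simp
    also have "\<dots> = u + u"
      unfolding jaut_add[OF assms] by (simp add: x[symmetric])
    finally show "J u + J u = u + u" .
  qed
qed

text \<open>Twice \<open>x * y * x\<close> is a Jordan polynomial in \<open>x\<close> and
  \<open>y\<close>, and halving is possible.\<close>

lemma jaut_triple:
  assumes J: "jaut J" shows "J (x * y * x) = J x * J y * J x"
proof (rule double_cancel)
  have "x * y * x + x * y * x =
    (x * (x * y + y * x) + (x * y + y * x) * x) - ((x * x) * y + y * (x * x))"
    by (simp add: algebra_simps)
  then have "J (x * y * x) + J (x * y * x) =
    J ((x * (x * y + y * x) + (x * y + y * x) * x) - ((x * x) * y + y * (x * x)))"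
    using jaut_add[OF J] by metis
  also have "\<dots> = J x * J y * J x + J x * J y * J x"
    unfolding jaut_diff[OF J] jaut_jordan[OF J] jaut_square[OF J] by (simp add: algebra_simps)
  finally show "J (x * y * x) + J (x * y * x) = J x * J y * J x + J x * J y * J x" .
qed

lemma jaut_triple_sym:
  assumes J: "jaut J"
  shows "J (x * y * z + z * y * x) = J x * J y * J z + J z * J y * J x"
proof -
  have "x * y * z + z * y * x = (x + z) * y * (x + z) - x * y * x - z * y * z"
    by (simp add: algebra_simps)
  then have "J (x * y * z + z * y * x) = J ((x + z) * y * (x + z) - x * y * x - z * y * z)"
    by simp
  also have "\<dots> = J x * J y * J z + J z * J y * J x"
    unfolding jaut_diff[OF J] jaut_triple[OF J] jaut_add[OF J] by (simp add: algebra_simps)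
  finally show ?thesis .
qed

text \<open>Applying the relation in two ways to \<open>a * z * b * w * a\<close> shows that
  \<open>a * z * (a * w * b)\<close> equals its own negative. Two uses of primeness finish the
  argument.\<close>

lemma prime_skew:
  fixes a b :: 'a
  assumes skew: "\<And>z. a * z * b + b * z * a = 0"
  shows "a = 0 \<or> b = 0"
proof -
  have eq: "b * z * a = - (a * z * b)" for z
    using skew[of z] by (simp add: eq_neg_iff_add_eq_0 add.commute)
  have "a * z * (a * w * b) = 0" for z w
  proof (rule double_cancel)
    have "a * z * (b * w * a) = (a * z * b) * w * a" by (simp add: mult.assoc)
    also have "a * z * b = - (b * z * a)" by (simp add: eq)
    also have "- (b * z * a) * w * a = - (b * (z * a * w) * a)" by (simp add: mult.assoc)
    also have "\<dots> = a * (z * a * w) * b" by (simp add: eq[of "z * a * w"])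
    also have "\<dots> = a * z * (a * w * b)" by (simp add: mult.assoc)
    finally have "a * z * (b * w * a) = a * z * (a * w * b)" .
    moreover have "a * z * (b * w * a) = - (a * z * (a * w * b))" by (simp add: eq[of w])
    ultimately show "a * z * (a * w * b) + a * z * (a * w * b) = 0 + 0"
      by (metis add.right_inverse add_0)
  qed
  then show ?thesis using prime[of a] by metis
qed

text \<open>Herstein's argument: the two defects \<open>J (x * y) - J x * J y\<close> and \<open>J (x * y) - J y * J x\<close>
  satisfy the skew relation of the previous lemma.\<close>
lemma jaut_mult_cases:
  assumes J: "jaut J"
  shows "J (x * y) = J x * J y \<and> J (y * x) = J y * J x \<or>
         J (x * y) = J y * J x \<and> J (y * x) = J x * J y"
proof -
  define a b c where "a = J (x * y)" and "b = J x * J y" and "c = J y * J x"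
  have yx: "J (y * x) = b + c - a"
    using jaut_jordan[OF J, of x y] jaut_add[OF J, of "x * y" "y * x"]
    by (simp add: a_def b_def c_def algebra_simps)
  have "(a - b) * z * (a - c) + (a - c) * z * (a - b) = 0" for z
  proof -
    obtain w where w: "z = J w" using jaut_surj[OF J] .
    \<comment> \<open>Applying \<open>J\<close> to both sides, the left through
      \<open>jaut_triple_sym\<close> and the right through nested \<open>jaut_triple\<close>, gives
      the skew relation.\<close>
    have "(x * y) * w * (y * x) + (y * x) * w * (x * y) = x * (y * w * y) * x + y * (x * w * x) * y"
      by (simp add: mult.assoc)
    moreover have "J ((x * y) * w * (y * x) + (y * x) * w * (x * y)) =
        a * z * (b + c - a) + (b + c - a) * z * a"
      unfolding jaut_triple_sym[OF J] by (simp only: w yx a_def)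
    moreover have "J (x * (y * w * y) * x + y * (x * w * x) * y) = b * z * c + c * z * b"
      unfolding jaut_add[OF J] jaut_triple[OF J] by (simp add: w b_def c_def mult.assoc)
    ultimately have "a * z * (b + c - a) + (b + c - a) * z * a = b * z * c + c * z * b"
      by simp
    then show ?thesis by (simp add: algebra_simps)
  qed
  then have "a - b = 0 \<or> a - c = 0" by (rule prime_skew)
  then show ?thesis using yx by (auto simp: a_def b_def c_def)
qed

text \<open>In both cases of \<open>jaut_mult_cases\<close>, a commutator goes to plus or minus the
  commutator of the images.\<close>

lemma jaut_commutators:
  assumes J: "jaut J" and "x \<in> commutators"
  shows "J x \<in> commutators"
proof -
  have "commutators \<subseteq> {x. J x \<in> commutators}"
  proof (rule commutators_subset)
    show "subspace {x. J x \<in> commutators}"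
      using subspace_commutators
      by (auto simp: subspace_def jaut_add[OF J] jaut_scale[OF J] jaut_zero[OF J])
    show "x * y - y * x \<in> {x. J x \<in> commutators}" for x y
      using jaut_mult_cases[OF J, of x y] commutator_mem by (auto simp: jaut_diff[OF J])
  qed
  then show ?thesis using assms by blast
qed

lemma jaut_center:
  assumes J: "jaut J" and k: "k \<in> center"
  shows "J k \<in> center"
proof -
  have "J k * y = y * J k" for y
  proof -
    obtain x where x: "y = J x" using jaut_surj[OF J] .
    show ?thesis
      using jaut_mult_cases[OF J, of k x] center_commute[OF k, of x] unfolding x by metis
  qed
  then show ?thesis by (simp add: center_def)
qed

lemma jaut_center_mult:
  assumes J: "jaut J" and k: "k \<in> center"
  shows "J (k * x) = J k * J x"
  using jaut_mult_cases[OF J, of k x] center_commute[OF jaut_center[OF J k], of "J x"] by metis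

lemma jaut_division_idempotent:
  assumes J: "jaut J" and e: "division_idempotent e"
  shows "division_idempotent (J e)"
proof -
  have ee: "e * e = e" "e \<noteq> 0" using e by (auto simp: division_idempotent_def)
  have f: "J e * J e = J e" "J e \<noteq> 0"
    using jaut_square[OF J, of e] jaut_eq_iff[OF J, of e 0] ee by (auto simp: jaut_zero[OF J])
  have corner: "J e * J x = J x \<and> J x * J e = J x" if "e * x = x" "x * e = x" for x
    using jaut_mult_cases[OF J, of e x] that by auto
  have "\<exists>z. J e * z = z \<and> z * J e = z \<and> y * z = J e \<and> z * y = J e"
    if y: "y \<noteq> 0 \<and> J e * y = y \<and> y * J e = y" for y
  proof -
    obtain x where x: "y = J x" using jaut_surj[OF J] .
    have "J (e * x * e) = J x"
      unfolding jaut_triple[OF J] using y x by auto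
    then have exe: "e * x * e = x" by (simp add: jaut_eq_iff[OF J])
    then have "e * x = x" "x * e = x"
      using ee by (metis mult.assoc)+
    moreover have "x \<noteq> 0" using y x jaut_zero[OF J] by auto
    ultimately obtain z where z: "e * z = z" "z * e = z" "x * z = e" "z * x = e"
      using e unfolding division_idempotent_def by blast
    then show ?thesis
      using corner[of z] jaut_mult_cases[OF J, of x z] x by auto
  qed
  then show ?thesis using f by (simp add: division_idempotent_def)
qed

text \<open>Powers of \<open>x\<close> commute with \<open>x\<close>, so both cases of
  \<open>jaut_mult_cases\<close> give the same product.\<close>

lemma jaut_corner_power:
  assumes J: "jaut J" and x: "e * x = x" "x * e = x"
  shows "J (corner_power e x n) = corner_power (J e) (J x) n"
proof (induction n)
  case (Suc n)
  have f: "J e * J x = J x" "J x * J e = J x"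
    using jaut_mult_cases[OF J, of e x] x by auto
  have "J (x * corner_power e x n) = J x * J (corner_power e x n)"
    using jaut_mult_cases[OF J, of x "corner_power e x n"] corner_power_commute[OF f, of n] Suc
    by auto
  then show ?case by (simp add: corner_power_Suc Suc)
qed simp

text \<open>On the corner \<open>e * A * e\<close>, a division ring, \<open>x\<close> and \<open>J x\<close> have the same minimal polynomial
  \<open>p\<close> over the center, so that dividing \<open>p X - p Y\<close> by \<open>X - Y\<close> yields a nonzero \<open>w\<close> with
  \<open>J x * w = w * x\<close>.\<close>
lemma jaut_intertwiner:
  assumes J: "jaut J" and central: "\<And>k. k \<in> center \<Longrightarrow> J k = k"
    and e: "e \<noteq> 0" "e * e = e" and x: "e * x = x" "x * e = x"
  obtains w where "w \<noteq> 0" "J e * w = w" "w * e = w" "J x * w = w * x"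
proof -
  define f y where "f = J e" and "y = J x"
  define X Y where "X = corner_power e x" and "Y = corner_power f y"
  obtain d k where k: "\<And>i. i < d \<Longrightarrow> k i \<in> center" "X d = (\<Sum>i<d. k i * X i)"
    and indep: "\<And>l j. \<lbrakk>\<And>i. i < d \<Longrightarrow> l i \<in> center; (\<Sum>i<d. l i * X i) = 0; j < d\<rbrakk> \<Longrightarrow> l j = 0"
    unfolding X_def using minimal_polynomial[of e x] by blast
  have X0: "X 0 = e" and XS: "X (Suc i) = x * X i" and Xx: "X i * x = x * X i" for i
    by (simp_all add: X_def corner_power_Suc corner_power_commute[OF x])
  have Y0: "Y 0 = f" and YS: "Y (Suc i) = y * Y i" for i
    by (simp_all add: Y_def corner_power_Suc)
  have JX: "J (X i) = Y i" for i
    by (simp add: X_def Y_def f_def y_def jaut_corner_power[OF J x])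
  have Jsum: "J (\<Sum>i<n. l i * X i) = (\<Sum>i<n. l i * Y i)" if "\<And>i. i < n \<Longrightarrow> l i \<in> center" for n l
    using that by (simp add: jaut_sum[OF J] jaut_center_mult[OF J] central JX)
  have Yd: "Y d = (\<Sum>i<d. k i * Y i)"
    using Jsum[of d k] k by (simp flip: JX)
  have fy: "f * f = f" "f * y = y" "y * f = y"
    using jaut_mult_cases[OF J, of e x] jaut_square[OF J, of e] e x by (auto simp: f_def y_def)
  have "d \<noteq> 0" using k(2) X0 e by (cases d) auto
  \<comment> \<open>Horner's scheme for the minimal polynomial \<open>p\<close> at \<open>x\<close>,
    reading the coefficients from the top; \<open>c d\<close> is the value of \<open>p\<close> at
    \<open>x\<close>.\<close>
  define c where "c = rec_nat e (\<lambda>i r. r * x - k (d - Suc i) * e)"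
  have c0: "c 0 = e" and cS: "c (Suc i) = c i * x - k (d - Suc i) * e" for i
    by (simp_all add: c_def)
  have ce: "c i * e = c i" for i
    by (induction i) (simp_all add: c0 cS e x left_diff_distrib mult.assoc)
  have "c n = X n - (\<Sum>i<n. k (d - n + i) * X i)" if "n \<le> d" for n
    using that
  proof (induction n)
    case (Suc n)
    have "d - Suc n + Suc i = d - n + i" for i using Suc.prems by linarith
    then have "(\<Sum>i<Suc n. k (d - Suc n + i) * X i) =
        k (d - Suc n) * e + (\<Sum>i<n. k (d - n + i) * X (Suc i))"
      by (simp only: sum.lessThan_Suc_shift X0 add_0_right)
    moreover have "c n * x = X (Suc n) - (\<Sum>i<n. k (d - n + i) * X (Suc i))"
      using Suc by (simp add: left_diff_distrib sum_distrib_right mult.assoc Xx XS)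
    ultimately show ?case by (simp add: cS)
  qed (simp add: c0 X0)
  from this[of d] have cd: "c d = 0" using k(2) by simp
  \<comment> \<open>The difference quotient of \<open>p\<close>, with powers of \<open>y\<close> on
    the left, Horner remainders in \<open>x\<close> on the right, and \<open>z\<close> in the
    middle.\<close>
  define w where "w z = (\<Sum>j<d. Y j * z * c (d - Suc j))" for z
  have "y * w z = w z * x" for z
  proof -
    have "w z * x = (\<Sum>j<d. Y j * z * c (d - j)) + Y d * z * e"
    proof -
      have "Y j * z * c (d - Suc j) * x = Y j * z * c (d - j) + k j * Y j * z * e" if "j < d" for j
      proof -
        have "d - j = Suc (d - Suc j)" "d - Suc (d - Suc j) = j" using that by auto
        then have "c (d - Suc j) * x = c (d - j) + k j * e" by (simp add: cS)
        then show ?thesis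
          using center_left_commute[OF k(1)[OF that], of "Y j * z" e]
          by (simp add: mult.assoc distrib_left)
      qed
      then show ?thesis
        by (simp add: w_def sum_distrib_right sum.distrib Yd)
    qed
    also have "(\<Sum>j<d. Y j * z * c (d - j)) + Y d * z * e = (\<Sum>j<Suc d. Y j * z * c (d - j))"
      by (simp add: c0)
    \<comment> \<open>The term at index 0 disappears because \<open>c d = 0\<close>.\<close>
    also have "\<dots> = (\<Sum>j<d. Y (Suc j) * z * c (d - Suc j))"
      unfolding sum.lessThan_Suc_shift by (simp add: cd)
    also have "\<dots> = y * w z"
      by (simp add: w_def sum_distrib_left YS mult.assoc)
    finally show ?thesis by simp
  qed
  moreover have "f * w z = w z" for z
  proof -
    have "f * Y j = Y j" for j
      unfolding Y_def by (rule corner_power_closed[OF fy])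
    then show ?thesis by (simp add: w_def sum_distrib_left flip: mult.assoc)
  qed
  moreover have "w z * e = w z" for z
    by (simp add: w_def sum_distrib_right mult.assoc ce)
  \<comment> \<open>If all \<open>w z\<close> vanished, swapping the factors and using
    \<open>c 0 = e\<close> at index \<open>d - 1\<close> would make the powers of \<open>y\<close>
    dependent over the center. Applying the inverse of \<open>J\<close> would contradict
    \<open>indep\<close>.\<close>
  moreover have "\<exists>z. w z \<noteq> 0"
  proof (rule ccontr)
    assume "\<not> ?thesis"
    then have w0: "(\<Sum>j<d. Y j * z * c (d - Suc j)) = 0" for z
      by (simp add: w_def)
    have "(\<Sum>j<d. c (d - Suc j) * z * Y j) = 0" for z
      by (rule swap_relation[OF _ w0]) simp
    then obtain l where l: "\<And>i. i \<in> {..<d} \<Longrightarrow> l i \<in> center" "\<exists>i\<in>{..<d}. l i \<noteq> 0"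
      "(\<Sum>i<d. l i * Y i) = 0"
      using center_dependent[of "{..<d}" "\<lambda>j. c (d - Suc j)" Y "d - 1"] \<open>d \<noteq> 0\<close> c0 e
      by auto
    then have "J (\<Sum>i<d. l i * X i) = J 0" by (simp add: Jsum jaut_zero[OF J])
    then have "(\<Sum>i<d. l i * X i) = 0" by (simp add: jaut_eq_iff[OF J])
    then show False using indep l by auto
  qed
  ultimately show ?thesis using that by (auto simp: f_def y_def)
qed

text \<open>This fixes the sign of a central-linear Jordan automorphism on the one-dimensional quotient
  by the commutators.\<close>
lemma central_jaut_diff:
  assumes J: "jaut J" and central: "\<And>k. k \<in> center \<Longrightarrow> J k = k"
  shows "J x - x \<in> commutators"
proof -
  obtain e :: 'a where e: "division_idempotent e" using division_idempotent_exists .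
  then have ee: "e \<noteq> 0" "e * e = e" by (auto simp: division_idempotent_def)
  define f where "f = J e"
  have f: "division_idempotent f" unfolding f_def using J e by (rule jaut_division_idempotent)
  obtain x' where x': "e * x' = x'" "x' * e = x'" "x - x' \<in> commutators"
    using corner_representative[OF e] .
  obtain w where w: "w \<noteq> 0" "f * w = w" "w * e = w" "J x' * w = w * x'"
    unfolding f_def using jaut_intertwiner[OF J central ee x'(1,2)] by blast
  obtain v where v: "w * v = f" using division_idempotent_right_inverse[OF f w(1,2)] .
  define w' where "w' = e * v * f"
  have ff: "f * f = f" using f by (simp add: division_idempotent_def)
  have ww': "w * w' = f"
    by (simp add: w'_def ff v w flip: mult.assoc)
  \<comment> \<open>A nonzero idempotent of a division ring is its unit, so \<open>g = e\<close> and
    \<open>w'\<close> inverts \<open>w\<close> between the two corners.\<close>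
  define g where "g = w' * w"
  have "w * g = w" using ww' w by (simp add: g_def flip: mult.assoc)
  then have g0: "g \<noteq> 0" using w by auto
  have eg: "e * g = g" "g * e = g"
    using w ee by (simp_all add: g_def w'_def mult.assoc) (simp flip: mult.assoc)
  have gg: "g * g = g"
    using \<open>w * g = w\<close> by (simp add: g_def mult.assoc)
  obtain h where "g * h = e" using e g0 eg unfolding division_idempotent_def by blast
  then have ge: "g = e" using gg eg by (metis mult.assoc)
  have "J x' * f = J x'"
    using jaut_mult_cases[OF J, of e x'] x' by (auto simp: f_def)
  then have "J x' = w * (x' * w')"
    using ww' w(4) by (metis mult.assoc)
  \<comment> \<open>Thus \<open>J x'\<close> and \<open>x'\<close> are the two products of
    \<open>w\<close> and \<open>x' * w'\<close>.\<close>
  moreover have "x' = (x' * w') * w"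
    using ge x' by (simp add: g_def mult.assoc)
  ultimately have "J x' - x' \<in> commutators"
    using commutator_mem[of w "x' * w'"] by simp
  moreover have "J (x - x') - (x - x') \<in> commutators"
    using jaut_commutators[OF J x'(3)] x'(3) subspace_commutators by (simp add: subspace_diff)
  moreover have "J x - x = (J (x - x') - (x - x')) + (J x' - x')"
    by (simp add: jaut_diff[OF J])
  ultimately show ?thesis using subspace_add[OF subspace_commutators] by metis
qed

section \<open>The invariant subspace\<close>

text \<open>By \<open>jaut_center_mult\<close> the restrictions to the center are field
  homomorphisms; they play the role of Dedekind's characters.\<close>

definition distinct_on_center :: "('a \<Rightarrow> 'a) set \<Rightarrow> bool" where
  "distinct_on_center S \<longleftrightarrow> (\<forall>J\<in>S. jaut J) \<and>
     (\<forall>J\<in>S. \<forall>L\<in>S. J \<noteq> L \<longrightarrow> (\<exists>k\<in>center. J k \<noteq> L k))"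

text \<open>Dedekind's theorem with coefficients in \<open>A\<close> modulo \<open>W\<close>. The
  case \<open>W = {0}\<close> bounds the number of restrictions, and \<open>W = commutators\<close>
  shows that the invariant subspace is proper.\<close>

lemma dedekind_independence:
  fixes v :: "('a \<Rightarrow> 'a) \<Rightarrow> 'a"
  assumes "finite S" "distinct_on_center S"
    and W: "subspace W" "\<And>k x. k \<in> center \<Longrightarrow> x \<in> W \<Longrightarrow> k * x \<in> W"
    and "\<And>k. k \<in> center \<Longrightarrow> (\<Sum>J\<in>S. J k * v J) \<in> W" "J \<in> S"
  shows "v J \<in> W"
proof -
  have "\<forall>J\<in>S. v J \<in> W"
    using assms(1,2,5)
  proof (induction S arbitrary: v rule: finite_induct)
    case (insert J S)
    have J: "jaut J" and S: "\<And>L. L \<in> S \<Longrightarrow> jaut L"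
      and distinct: "\<And>L. L \<in> S \<Longrightarrow> \<exists>l\<in>center. J l \<noteq> L l"
      using insert.prems(1) insert.hyps by (auto simp: distinct_on_center_def)
    have split: "J k * v J + (\<Sum>L\<in>S. L k * v L) \<in> W" if "k \<in> center" for k
      using insert.prems(2)[OF that] insert.hyps by simp
    have "distinct_on_center S" using insert.prems(1) by (auto simp: distinct_on_center_def)
    have vL: "v L \<in> W" if "L \<in> S" for L
    proof -
      obtain l where l: "l \<in> center" "J l \<noteq> L l" using distinct \<open>L \<in> S\<close> by blast
      have "\<forall>L\<in>S. (L l - J l) * v L \<in> W"
      proof (rule insert.IH)
        fix k :: 'a assume k: "k \<in> center"
        let ?sum = "\<lambda>k. J k * v J + (\<Sum>L\<in>S. L k * v L)"
        \<comment> \<open>The relation at \<open>k * l\<close> minus \<open>J l\<close> times the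
          relation at \<open>k\<close> eliminates \<open>J\<close>.\<close>
        have "?sum (k * l) - J l * ?sum k \<in> W"
          using k l split W jaut_center[OF J] by (simp add: center_mult subspace_diff)
        also have "?sum (k * l) - J l * ?sum k =
            (\<Sum>L\<in>S. L (k * l) * v L) - (\<Sum>L\<in>S. J l * (L k * v L))"
          using k l center_commute[OF jaut_center[OF J k], of "J l"]
          by (simp add: jaut_center_mult[OF J] distrib_left sum_distrib_left flip: mult.assoc)
        also have "\<dots> = (\<Sum>L\<in>S. L k * ((L l - J l) * v L))"
          unfolding sum_subtractf[symmetric]
        proof (rule sum.cong)
          fix L assume "L \<in> S"
          note L = S[OF this]
          show "L (k * l) * v L - J l * (L k * v L) = L k * ((L l - J l) * v L)"
            using center_left_commute[OF jaut_center[OF L k], of "J l" "v L"] k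
            by (simp add: jaut_center_mult[OF L] left_diff_distrib right_diff_distrib mult.assoc)
        qed simp
        finally show "(\<Sum>L\<in>S. L k * ((L l - J l) * v L)) \<in> W" .
      qed fact
      then have "(L l - J l) * v L \<in> W" using \<open>L \<in> S\<close> by blast
      moreover obtain h where "h \<in> center" "h * (L l - J l) = u"
        using center_inverse[of "L l - J l"] l jaut_center[OF J] jaut_center[OF S[OF \<open>L \<in> S\<close>]]
        by (auto simp: center_diff)
      ultimately show ?thesis using W(2)[of h "(L l - J l) * v L"] by (simp flip: mult.assoc)
    qed
    have "(\<Sum>L\<in>S. L u * v L) \<in> W"
      using vL S W by (intro subspace_sum) (auto simp: jaut_unit)
    then have "(J u * v J + (\<Sum>L\<in>S. L u * v L)) - (\<Sum>L\<in>S. L u * v L) \<in> W"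
      using split[of u] W(1) by (intro subspace_diff) auto
    then have "v J \<in> W" by (simp add: jaut_unit[OF J])
    then show ?case using vL by blast
  qed simp
  then show ?thesis using assms by blast
qed

text \<open>More restrictions than basis elements of the center would satisfy a nontrivial linear
  relation, against Dedekind. A set of largest size therefore exists and represents every
  restriction.\<close>

lemma center_representatives:
  obtains S where "finite S" "distinct_on_center S"
    "\<And>J. jaut J \<Longrightarrow> \<exists>L\<in>S. \<forall>k\<in>center. L k = J k"
proof -
  obtain B where B: "B \<subseteq> center" "independent B" "center \<subseteq> span B"
    by (rule basis_exists[of center])
  have finB: "finite B" using B(2) by (rule finiteI_independent)
  have bound: "card S \<le> card B" if S: "finite S" "distinct_on_center S" for S
  proof (rule ccontr)
    assume "\<not> ?thesis"
    then have less: "card B < card S" by simp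
    have jS: "jaut J" if "J \<in> S" for J
      using that S by (simp add: distinct_on_center_def)
    obtain c where c: "\<And>J. J \<in> S \<Longrightarrow> c J \<in> center" "\<exists>J\<in>S. c J \<noteq> 0"
      "\<And>b. b \<in> B \<Longrightarrow> (\<Sum>J\<in>S. c J * J b) = 0"
      using center_system_nontrivial[OF finB S(1) less, of "\<lambda>J b. J b"] B(1) jS jaut_center
      by blast
    have "span B \<subseteq> {x. (\<Sum>J\<in>S. c J * J x) = 0}"
    proof (rule span_minimal)
      show "subspace {x. (\<Sum>J\<in>S. c J * J x) = 0}"
        using jS by (auto simp: subspace_def jaut_add jaut_scale jaut_zero distrib_left
            sum.distrib scale_mult_right simp flip: scale_sum_right)
    qed (use c in auto)
    then have relation: "(\<Sum>J\<in>S. c J * J k) = 0" if "k \<in> center" for k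
      using B(3) that by blast
    have vanish: "(\<Sum>J\<in>S. J k * c J) \<in> {0}" if k: "k \<in> center" for k
    proof -
      have "(\<Sum>J\<in>S. J k * c J) = (\<Sum>J\<in>S. c J * J k)"
      proof (rule sum.cong[OF refl])
        fix J assume "J \<in> S"
        then show "J k * c J = c J * J k"
          by (rule center_commute[OF jaut_center[OF jS k]])
      qed
      then show ?thesis using relation[OF k] by simp
    qed
    have "c J \<in> {0}" if "J \<in> S" for J
      by (rule dedekind_independence[OF S, where W = "{0}" and v = c])
        (use that vanish in \<open>auto simp: subspace_def\<close>)
    then show False using c(2) by blast
  qed
  let ?P = "\<lambda>S. finite S \<and> distinct_on_center S"
  have "\<exists>S. ?P S \<and> (\<forall>R. ?P R \<longrightarrow> card R \<le> card S)"
    by (rule ex_has_greatest_nat[of ?P "{}" _ "Suc (card B)"])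
      (use bound in \<open>auto simp: distinct_on_center_def le_imp_less_Suc\<close>)
  then obtain S where S: "finite S" "distinct_on_center S"
    and max: "\<And>R. ?P R \<Longrightarrow> card R \<le> card S" by blast
  have "\<exists>L\<in>S. \<forall>k\<in>center. L k = J k" if J: "jaut J" for J
  proof (rule ccontr)
    assume neg: "\<not> ?thesis"
    then have "J \<notin> S" by blast
    moreover have "distinct_on_center (insert J S)"
      using S(2) J neg unfolding distinct_on_center_def by (metis insert_iff)
    ultimately show False using max[of "insert J S"] S(1) by simp
  qed
  then show ?thesis using that S by blast
qed

text \<open>The invariant subspace consists of the \<open>x\<close> for which \<open>\<Sum>J\<in>S. J x\<close> is a sum of commutators,
  where \<open>S\<close> represents the finitely many restrictions of Jordan automorphisms to the center.\<close>
lemma invariant_subspace_exists: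
  obtains N where "subspace N" "N \<noteq> UNIV" "\<And>x y. x * y - y * x \<in> N"
    "\<And>J x. jaut J \<Longrightarrow> J x - x \<in> N"
proof -
  obtain S where S: "finite S" "distinct_on_center S"
    and rep: "\<And>J. jaut J \<Longrightarrow> \<exists>L\<in>S. \<forall>k\<in>center. L k = J k"
    using center_representatives by blast
  have jS: "jaut J" if "J \<in> S" for J
    using that S by (simp add: distinct_on_center_def)
  define \<phi> where "\<phi> x = (\<Sum>J\<in>S. J x)" for x
  have \<phi>_diff: "\<phi> (x - y) = \<phi> x - \<phi> y" for x y
    by (simp add: \<phi>_def jS jaut_diff flip: sum_subtractf)
  define N where "N = {x. \<phi> x \<in> commutators}"
  have "subspace N"
  proof (rule subspaceI)
    show "x + y \<in> N" if "x \<in> N" "y \<in> N" for x y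
      using that subspace_commutators
      by (simp add: N_def \<phi>_def jS jaut_add sum.distrib subspace_add)
    show "scale c x \<in> N" if "x \<in> N" for c x
      using that subspace_commutators
      by (simp add: N_def \<phi>_def jS jaut_scale subspace_scale flip: scale_sum_right)
    show "0 \<in> N" by (simp add: N_def \<phi>_def jS jaut_zero subspace_0[OF subspace_commutators])
  qed
  moreover have "N \<noteq> UNIV"
  proof
    assume all: "N = UNIV"
    \<comment> \<open>The identity is a Jordan automorphism, so \<open>S\<close> contains a
      representative of it.\<close>
    obtain J where J: "J \<in> S"
      using rep[of "\<lambda>x. x"] by (auto simp: jordan_automorphism_def linear_id[unfolded id_def] bij_def)
    have "J x \<in> commutators" for x
    proof (rule dedekind_independence[OF S subspace_commutators, where v = "\<lambda>J. J x"])
      fix k :: 'a assume k: "k \<in> center"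
      have "\<phi> (k * x) \<in> commutators" using all by (auto simp: N_def)
      then show "(\<Sum>J\<in>S. J k * J x) \<in> commutators"
        using k by (simp add: \<phi>_def jS jaut_center_mult)
    qed (use J commutators_center_mult in auto)
    then have "commutators = UNIV"
      using jaut_surj[OF jS[OF J]] by (metis UNIV_eq_I)
    then show False using commutators_proper by simp
  qed
  moreover have "x * y - y * x \<in> N" for x y
    unfolding N_def \<phi>_def mem_Collect_eq
    by (rule subspace_sum[OF subspace_commutators]) (rule jaut_commutators[OF jS commutator_mem])
  moreover have "H x - x \<in> N" if H: "jaut H" for H x
  proof -
    \<comment> \<open>Composition with \<open>H\<close> permutes the restrictions to the center,
      hence induces a permutation \<open>p\<close> of \<open>S\<close>.\<close>
    have "\<forall>J\<in>S. \<exists>L\<in>S. \<forall>k\<in>center. L k = J (H k)"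
      using rep[OF jaut_comp[OF jS H]] by blast
    then obtain p where p: "\<And>J. J \<in> S \<Longrightarrow> p J \<in> S"
      "\<And>J k. J \<in> S \<Longrightarrow> k \<in> center \<Longrightarrow> p J k = J (H k)" by metis
    have "inj_on p S"
    proof (rule inj_onI, rule ccontr)
      fix J L assume JL: "J \<in> S" "L \<in> S" "p J = p L" "J \<noteq> L"
      then obtain k where k: "k \<in> center" "J k \<noteq> L k"
        using S(2) unfolding distinct_on_center_def by blast
      have "inv H k \<in> center" using jaut_center[OF jaut_inv[OF H] k(1)] .
      moreover have "H (inv H k) = k" using jaut_bij[OF H] by (simp add: bij_def surj_f_inv_f)
      ultimately show False using p(2)[of J "inv H k"] p(2)[of L "inv H k"] JL k by simp
    qed
    then have "bij_betw p S S"
      using S(1) p(1) by (intro bij_betw_imageI endo_inj_surj) auto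
    then have reindex: "\<phi> x = (\<Sum>J\<in>S. p J x)"
      unfolding \<phi>_def by (simp add: sum.reindex_bij_betw[of p S S "\<lambda>J. J x"])
    have "J (H x) - p J x \<in> commutators" if J: "J \<in> S" for J
    proof -
      note L = jS[OF p(1)[OF J]]
      have inv: "inv (p J) (p J y) = y" "p J (inv (p J) y) = y" for y
        using jaut_bij[OF L] by (auto simp: bij_def surj_f_inv_f)
      \<comment> \<open>This composite fixes the center pointwise, so
        \<open>central_jaut_diff\<close> applies.\<close>
      have "jaut (\<lambda>x. inv (p J) (J (H x)))"
        by (intro jaut_comp[OF jaut_inv[OF L] jaut_comp[OF jS[OF J] H]])
      then have "inv (p J) (J (H x)) - x \<in> commutators"
        by (rule central_jaut_diff) (use p(2)[OF J] inv in metis)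
      then have "p J (inv (p J) (J (H x)) - x) \<in> commutators"
        by (rule jaut_commutators[OF L])
      then show ?thesis by (simp add: jaut_diff[OF L] inv)
    qed
    then have "(\<Sum>J\<in>S. J (H x) - p J x) \<in> commutators"
      by (rule subspace_sum[OF subspace_commutators])
    then show ?thesis
      unfolding N_def \<phi>_diff mem_Collect_eq by (simp add: reindex sum_subtractf) (simp add: \<phi>_def)
  qed
  ultimately show ?thesis using that by blast
qed

section \<open>Linearizing the power congruences of a local Jordan automorphism\<close>

lemma local_jaut_is_jaut:
  assumes char_not_3: "(3::'f) \<noteq> 0" and T: "local_jordan_automorphism scale T"
  shows "jaut T"
proof -
  obtain N where N: "subspace N" "N \<noteq> UNIV" "\<And>x y. x * y - y * x \<in> N"
    "\<And>J x. jaut J \<Longrightarrow> J x - x \<in> N"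
    by (rule invariant_subspace_exists) blast
  have lin: "Vector_Spaces.linear scale scale T"
    and loc: "\<And>x. \<exists>J. jaut J \<and> T x = J x"
    using T by (auto simp: local_jordan_automorphism_def)
  have T_add: "T (x + y) = T x + T y" for x y
    using lin by (simp add: Vector_Spaces.linear_iff)
  interpret T: Vector_Spaces.linear scale scale T by fact
  have "inj T"
    unfolding T.inj_iff_eq_0 using loc by (metis jaut_eq_iff jaut_zero)
  then have "surj T" using linear_inj_imp_surj[OF lin] by simp
  have cong_trans: "x - z \<in> N" if "x - y \<in> N" "y - z \<in> N" for x y z
    using subspace_add[OF N(1) that] by simp
  have cong_sym: "y - x \<in> N" if "x - y \<in> N" for x y
    using subspace_neg[OF N(1) that] by simp
  have half: "x \<in> N" if "x + x \<in> N" for x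
  proof -
    have "scale (1 / 2) (x + x) = x" using char_not_2 by (simp flip: scale_two)
    then show ?thesis using subspace_scale[OF N(1) that, of "1 / 2"] by simp
  qed
  have third: "x \<in> N" if "x + x + x \<in> N" for x
  proof -
    have "scale (1 / 3) (x + x + x) = x" using char_not_3 by (simp flip: scale_three)
    then show ?thesis using subspace_scale[OF N(1) that, of "1 / 3"] by simp
  qed
  have T1: "T x - x \<in> N" for x
    using loc[of x] N(4) by auto
  have T2: "T x * T x - x * x \<in> N" for x
    using loc[of x] N(4)[of _ "x * x"] by (auto simp: jaut_square)
  have T3: "T x * T x * T x - x * x * x \<in> N" for x
    using loc[of x] N(4)[of _ "x * x * x"] by (auto simp: jaut_triple)
  have product: "T x * T y - x * y \<in> N" for x y
  proof (rule half)
    \<comment> \<open>The polarized square gives the symmetrized product; adding commutators merges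
      its two halves.\<close>
    have "(T (x + y) * T (x + y) - (x + y) * (x + y)) - (T x * T x - x * x) - (T y * T y - y * y) \<in> N"
      by (rule subspace_diff[OF N(1) subspace_diff[OF N(1) T2 T2] T2])
    from subspace_add[OF N(1) subspace_diff[OF N(1) this N(3)[of "T y" "T x"]] N(3)[of y x]]
    have "(T (x + y) * T (x + y) - (x + y) * (x + y)) - (T x * T x - x * x) - (T y * T y - y * y)
      - (T y * T x - T x * T y) + (y * x - x * y) \<in> N" .
    then show "T x * T y - x * y + (T x * T y - x * y) \<in> N"
      by (simp add: T_add algebra_simps)
  qed
  have triple: "(T x * T y + T y * T x) * T z - (x * y + y * x) * z \<in> N" for x y z
  proof (rule third)
    define q where "q x = T x * T x * T x - x * x * x" for x
    \<comment> \<open>Polarizing the cube yields all six orderings. The elements \<open>s\<close>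
      rotate the factors cyclically, leaving three copies of the desired expression.\<close>
    define s where "s x y z = x * (y * z) - (y * z) * x" for x y z :: 'a
    have "q x \<in> N" "s x y z \<in> N" for x y z
      unfolding q_def s_def by (rule T3 N(3))+
    then have "q (x + y + z) - q (x + y) - q (y + z) - q (x + z) + q x + q y + q z
      + (s (T x) (T y) (T z) - s (T z) (T x) (T y))
      + (s (T y) (T x) (T z) - s (T z) (T y) (T x))
      - (s x y z - s z x y) - (s y x z - s z y x) \<in> N"
      by (intro subspace_diff subspace_add N(1))
    then show "(T x * T y + T y * T x) * T z - (x * y + y * x) * z +
      ((T x * T y + T y * T x) * T z - (x * y + y * x) * z) +
      ((T x * T y + T y * T x) * T z - (x * y + y * x) * z) \<in> N"
      by (simp add: q_def s_def T_add algebra_simps)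
  qed
  have "T (x * y + y * x) = T x * T y + T y * T x" for x y
  proof -
    define a where "a = T (x * y + y * x) - (T x * T y + T y * T x)"
    have aN: "a * z \<in> N" for z
    proof -
      obtain w where w: "z = T w" using \<open>surj T\<close> by blast
      have "(T (x * y + y * x) * T w - (x * y + y * x) * w)
        - ((T x * T y + T y * T x) * T w - (x * y + y * x) * w) \<in> N"
        by (rule subspace_diff[OF N(1) product triple])
      then show ?thesis by (simp add: a_def w left_diff_distrib)
    qed
    have "a = 0"
    proof (rule ccontr)
      assume "a \<noteq> 0"
      have "m a \<in> N" if "m \<in> multiplications" for m
        using that
      proof induction
        case (elementary b c)
        \<comment> \<open>Modulo commutators, \<open>b * a * c\<close> is congruent to
          \<open>a * (c * b)\<close>.\<close>
        have "(b * (a * c) - (a * c) * b) + a * (c * b) \<in> N"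
          by (rule subspace_add[OF N(1) N(3) aN])
        then show ?case by (simp add: mult.assoc)
      qed (simp add: subspace_add N)
      then have "x \<in> N" for x
        using multiplications_transitive[OF \<open>a \<noteq> 0\<close>, of x] by metis
      then show False using N(2) by blast
    qed
    then show ?thesis by (simp add: a_def)
  qed
  then show ?thesis
    using lin \<open>inj T\<close> \<open>surj T\<close> by (simp add: jordan_automorphism_def bij_def)
qed

end

theorem theorem3p11:
  fixes scale :: "'f::field \<Rightarrow> 'a::ring \<Rightarrow> 'a" and T :: "'a \<Rightarrow> 'a"
  assumes "simple_algebra scale"
    and "fin_dim_algebra scale"
    and "(2::'f) \<noteq> 0" and "(3::'f) \<noteq> 0"
    and "local_jordan_automorphism scale T"
  shows "jordan_automorphism scale T"
proof -
  have alg: "vector_space scale" "\<And>c x y. scale c (x * y) = scale c x * y"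
    "\<And>c x y. scale c (x * y) = x * scale c y"
    using assms(1) unfolding simple_algebra_def is_algebra_def by blast+
  interpret vector_space scale by fact
  obtain G where G: "finite G" "span G = UNIV"
    using assms(2) by (auto simp: fin_dim_algebra_def)
  \<comment> \<open>The locale asks for a finite basis, extracted here from the finite spanning
    set.\<close>
  obtain B where B: "B \<subseteq> G" "independent B" "G \<subseteq> span B"
    using maximal_independent_subset[of G] by blast
  have "span B = UNIV" using B(3) G(2) span_mono[of G "span B"] by (auto simp: span_span)
  interpret fd_simple_algebra scale B
  proof
    show "I = {0} \<or> I = UNIV" if "subspace I" "\<And>a x. a \<in> I \<Longrightarrow> x * a \<in> I"
      "\<And>a x. a \<in> I \<Longrightarrow> a * x \<in> I" for I
      using assms(1) that by (auto simp: simple_algebra_def alg_ideal_def)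
    show "\<exists>x y::'a. x * y \<noteq> 0" using assms(1) by (simp add: simple_algebra_def)
    show "finite B" using B(1) G(1) by (rule finite_subset)
  qed (fact B(2) \<open>span B = UNIV\<close> alg(2,3)[symmetric])+
  obtain u :: 'a where u: "\<And>x. u * x = x" "\<And>x. x * u = x" using unit_exists by blast
  interpret jordan_simple_algebra scale B u
    by standard (use u assms(3) in auto)
  show ?thesis using assms(4,5) by (rule local_jaut_is_jaut)
qed

end
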